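(* The point $p=0$ is an accumulation point of $\mathrm{Forb}(K_{3,3})$, and $p=0$ is an accumulation point of $\mathrm{Forb}(K_{2,t})$ for every integer $t\geq 9$.
   Context: All graphs are finite and simple; $K_{s,t}$ is the complete bipartite graph with parts of sizes $s$ and $t$. For a graph $H$, $\mathrm{Forb}(H)$ is the family of all graphs not containing $H$ as an induced subgraph; for a family $\mathcal F$ of graphs, $\mathrm{Forb}(\mathcal F)=\bigcap_{F\in\mathcal F}\mathrm{Forb}(F)$. A hereditary property is a family of graphs closed under isomorphism and vertex-deletion (each is of the form $\mathrm{Forb}(\mathcal F)$); it is non-trivial if it contains graphs of unbounded order (and then it contains graphs of every order). Edit distance function. For graphs $G,H$ on the same vertex set $V$, $\mathrm{dist}(G,H)=|E(G)\triangle E(H)|/\binom{|V|}{2}$. For a non-trivial hereditary property $\mathcal H$, $\mathrm{dist}(G,\mathcal H)=\min\{\mathrm{dist}(G,H):H\in\mathcal H,\ V(H)=V(G)\}$, and $$\mathrm{ed}_{\mathcal H}(p)=\limsup_{n\to\infty}\max\Bigl\{\mathrm{dist}(G,\mathcal H):|V(G)|=n,\ |E(G)|=\Bigl\lfloor p\tbinom n2\Bigr\rfloor\Bigr\},\qquad p\in[0,1].$$ CRGs. A colored regularity graph (CRG) $K$ is a finite non-empty clique together with a partition of its vertices into black and white, $V(K)=VB(K)\sqcup VW(K)$, and a partition of its edges into black, white and gray, $E(K)=EB(K)\sqcup EW(K)\sqcup EG(K)$. For a graph $F$, write $F\mapsto K$ if there is a function $\phi\colon V(F)\to V(K)$ such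 that: for every $uv\in E(F)$, either $\phi(u)=\phi(v)\in VB(K)$ or $\phi(u)\phi(v)\in EB(K)\cup EG(K)$; and for every pair of distinct $u,v$ with $uv\notin E(F)$, either $\phi(u)=\phi(v)\in VW(K)$ or $\phi(u)\phi(v)\in EW(K)\cup EG(K)$. For a family $\mathcal F$, write $\mathcal F\mapsto K$ if $F\mapsto K$ for some $F\in\mathcal F$, and $\mathcal F\not\mapsto K$ otherwise. For $\mathcal H=\mathrm{Forb}(\mathcal F)$ non-trivial, $\mathcal K(\mathcal H)$ is the set of all CRGs $K$ with $\mathcal F\not\mapsto K$. For $p\in[0,1]$, $M_K(p)\in\mathbb R^{V(K)\times V(K)}$ is the matrix whose $(x,y)$ entry is $p$ if $x=y\in VW(K)$ or $xy\in EW(K)$; $1-p$ if $x=y\in VB(K)$ or $xy\in EB(K)$; and $0$ if $xy\in EG(K)$. Set $g_K(p)=\min\{\langle\mu,M_K(p)\mu\rangle:\mu\in\Delta^K\}$, where $\Delta^K$ is the set of all probability masses on $V(K)$. Accumulation points. Let $\mathcal H$ be a non-trivial hereditary property. A point $p_0\in[0,1]$ is a regular point of $\mathcal H$ if there are $\epsilon>0$ and a finite subset $\mathcal K'\subseteq\mathcal K(\mathcal H)$ such that $\mathrm{ed}_{\mathcal H}(p)=\min_{K\in\mathcal K'}g_K(p)$ for every $p\in(p_0-\epsilon,p_0+\epsilon)\cap[0,1]$. Otherwise $p_0$ is an accumulation point of $\mathcal H$. *)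

theory Defs
  imports "HOL-Analysis.Analysis"
begin

record 'a graph =
  verts :: "'a set"
  edges :: "'a set set"

definition pairs :: "'a set \<Rightarrow> 'a set set" where
  "pairs V = {e. e \<subseteq> V \<and> card e = 2}"

definition is_graph :: "'a graph \<Rightarrow> bool" where
  "is_graph G \<longleftrightarrow> finite (verts G) \<and> edges G \<subseteq> pairs (verts G)"

definition complete_bipartite :: "nat \<Rightarrow> nat \<Rightarrow> nat graph" where
  "complete_bipartite s t =
     \<lparr>verts = {..<s + t}, edges = {{i, j} | i j. i < s \<and> s \<le> j \<and> j < s + t}\<rparr>"

definition graph_iso :: "'a graph \<Rightarrow> 'b graph \<Rightarrow> bool" where
  "graph_iso G H \<longleftrightarrow>
     (\<exists>f. bij_betw f (verts G) (verts H) \<and> edges H = (\<lambda>e. f ` e) ` edges G)"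

definition delete_vertex :: "'a graph \<Rightarrow> 'a \<Rightarrow> 'a graph" where
  "delete_vertex G v = \<lparr>verts = verts G - {v}, edges = {e \<in> edges G. v \<notin> e}\<rparr>"

definition induced_subgraph :: "'a graph \<Rightarrow> 'b graph \<Rightarrow> bool" where
  "induced_subgraph F G \<longleftrightarrow>
     (\<exists>f. inj_on f (verts F) \<and> f ` verts F \<subseteq> verts G \<and>
          (\<forall>u\<in>verts F. \<forall>v\<in>verts F. {u, v} \<in> edges F \<longleftrightarrow> {f u, f v} \<in> edges G))"

text \<open>Graph families are sets of graphs with vertices in \<^typ>\<open>nat\<close>; every finite graph
  is isomorphic to one of these.\<close>

definition Forb :: "nat graph set \<Rightarrow> nat graph set" where
  "Forb \<F> = {G. is_graph G \<and> (\<forall>F\<in>\<F>. \<not> induced_subgraph F G)}"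

definition hereditary :: "nat graph set \<Rightarrow> bool" where
  "hereditary \<H> \<longleftrightarrow>
     (\<forall>G\<in>\<H>. is_graph G) \<and>
     (\<forall>G\<in>\<H>. \<forall>G'. is_graph G' \<and> graph_iso G G' \<longrightarrow> G' \<in> \<H>) \<and>
     (\<forall>G\<in>\<H>. \<forall>v\<in>verts G. delete_vertex G v \<in> \<H>)"

definition nontrivial :: "nat graph set \<Rightarrow> bool" where
  "nontrivial \<H> \<longleftrightarrow> (\<forall>n. \<exists>G\<in>\<H>. n \<le> card (verts G))"

definition edit_dist :: "'a graph \<Rightarrow> 'a graph \<Rightarrow> real" where
  "edit_dist G H =
     real (card ((edges G - edges H) \<union> (edges H - edges G))) / real (card (verts G) choose 2)"

definition edit_dist_to :: "nat graph \<Rightarrow> nat graph set \<Rightarrow> real" where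
  "edit_dist_to G \<H> = Min {edit_dist G H | H. H \<in> \<H> \<and> verts H = verts G}"

text \<open>The set below is finite although \<open>G\<close> ranges over infinitely many vertex sets, since
  the distances are multiples of \<open>1 / (n choose 2)\<close> in \<open>[0, 1]\<close>.\<close>

definition max_edit_dist :: "nat graph set \<Rightarrow> real \<Rightarrow> nat \<Rightarrow> real" where
  "max_edit_dist \<H> p n =
     Max {edit_dist_to G \<H> | G. is_graph G \<and> card (verts G) = n \<and>
            int (card (edges G)) = \<lfloor>p * real (n choose 2)\<rfloor>}"

text \<open>The sequence lies in \<open>[0, 1]\<close>, so the limit superior is finite.\<close>

definition ed :: "nat graph set \<Rightarrow> real \<Rightarrow> real" where
  "ed \<H> p = real_of_ereal (limsup (\<lambda>n. ereal (max_edit_dist \<H> p n)))"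

record 'a crg =
  VB :: "'a set"
  VW :: "'a set"
  EB :: "'a set set"
  EW :: "'a set set"
  EG :: "'a set set"

definition crg_verts :: "'a crg \<Rightarrow> 'a set" where
  "crg_verts K = VB K \<union> VW K"

definition is_crg :: "'a crg \<Rightarrow> bool" where
  "is_crg K \<longleftrightarrow>
     finite (crg_verts K) \<and> crg_verts K \<noteq> {} \<and> VB K \<inter> VW K = {} \<and>
     EB K \<union> EW K \<union> EG K = pairs (crg_verts K) \<and>
     EB K \<inter> EW K = {} \<and> EB K \<inter> EG K = {} \<and> EW K \<inter> EG K = {}"

definition maps_to :: "'a graph \<Rightarrow> 'b crg \<Rightarrow> bool" where
  "maps_to F K \<longleftrightarrow>
     (\<exists>\<phi>. \<phi> ` verts F \<subseteq> crg_verts K \<and>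
       (\<forall>u\<in>verts F. \<forall>v\<in>verts F. u \<noteq> v \<longrightarrow>
         (if {u, v} \<in> edges F
          then (\<phi> u = \<phi> v \<and> \<phi> u \<in> VB K) \<or> {\<phi> u, \<phi> v} \<in> EB K \<union> EG K
          else (\<phi> u = \<phi> v \<and> \<phi> u \<in> VW K) \<or> {\<phi> u, \<phi> v} \<in> EW K \<union> EG K)))"

definition family_maps_to :: "'a graph set \<Rightarrow> 'b crg \<Rightarrow> bool" where
  "family_maps_to \<F> K \<longleftrightarrow> (\<exists>F\<in>\<F>. maps_to F K)"

text \<open>The choice of \<open>\<F>\<close> with \<open>\<H> = Forb \<F>\<close> is immaterial, see \<open>crgs_Forb\<close> below.\<close>

definition crgs :: "nat graph set \<Rightarrow> nat crg set" where
  "crgs \<H> = {K. is_crg K \<and>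
     (\<exists>\<F>. (\<forall>F\<in>\<F>. is_graph F) \<and> \<H> = Forb \<F> \<and> \<not> family_maps_to \<F> K)}"

definition crg_matrix :: "'a crg \<Rightarrow> real \<Rightarrow> 'a \<Rightarrow> 'a \<Rightarrow> real" where
  "crg_matrix K p x y =
     (if (x = y \<and> x \<in> VW K) \<or> {x, y} \<in> EW K then p
      else if (x = y \<and> x \<in> VB K) \<or> {x, y} \<in> EB K then 1 - p
      else 0)"

definition masses :: "'a crg \<Rightarrow> ('a \<Rightarrow> real) set" where
  "masses K = {\<mu>. (\<forall>x. 0 \<le> \<mu> x) \<and> (\<forall>x. x \<notin> crg_verts K \<longrightarrow> \<mu> x = 0) \<and>
                  (\<Sum>x\<in>crg_verts K. \<mu> x) = 1}"

definition crg_form :: "'a crg \<Rightarrow> real \<Rightarrow> ('a \<Rightarrow> real) \<Rightarrow> real" where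
  "crg_form K p \<mu> = (\<Sum>x\<in>crg_verts K. \<Sum>y\<in>crg_verts K. \<mu> x * (crg_matrix K p x y * \<mu> y))"

text \<open>The infimum is a minimum, see \<open>crg_g_attained\<close> below.\<close>

definition crg_g :: "'a crg \<Rightarrow> real \<Rightarrow> real" where
  "crg_g K p = (INF \<mu>\<in>masses K. crg_form K p \<mu>)"

text \<open>The minimum over an empty set of CRGs is meaningless, whence \<open>\<K> \<noteq> {}\<close>.\<close>

definition regular_point :: "nat graph set \<Rightarrow> real \<Rightarrow> bool" where
  "regular_point \<H> p\<^sub>0 \<longleftrightarrow>
     (\<exists>\<epsilon>>0. \<exists>\<K>. finite \<K> \<and> \<K> \<noteq> {} \<and> \<K> \<subseteq> crgs \<H> \<and>
        (\<forall>p \<in> {p\<^sub>0 - \<epsilon><..<p\<^sub>0 + \<epsilon>} \<inter> {0..1}. ed \<H> p = (MIN K\<in>\<K>. crg_g K p)))"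

definition edit_accumulation_point :: "nat graph set \<Rightarrow> real \<Rightarrow> bool" where
  "edit_accumulation_point \<H> p\<^sub>0 \<longleftrightarrow>
     hereditary \<H> \<and> nontrivial \<H> \<and> p\<^sub>0 \<in> {0..1} \<and> \<not> regular_point \<H> p\<^sub>0"

lemma induced_subgraph_refl: "induced_subgraph G G"
  unfolding induced_subgraph_def by (rule exI[of _ id]) simp

lemma maps_to_induced_subgraph:
  assumes "induced_subgraph F G" "maps_to G K"
  shows "maps_to F K"
proof -
  obtain f where f: "inj_on f (verts F)" "f ` verts F \<subseteq> verts G"
    "\<And>u v. u \<in> verts F \<Longrightarrow> v \<in> verts F \<Longrightarrow> {u, v} \<in> edges F \<longleftrightarrow> {f u, f v} \<in> edges G"
    using assms(1) unfolding induced_subgraph_def by auto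
  obtain \<phi> where \<phi>: "\<phi> ` verts G \<subseteq> crg_verts K"
    "\<And>u v. u \<in> verts G \<Longrightarrow> v \<in> verts G \<Longrightarrow> u \<noteq> v \<Longrightarrow>
         (if {u, v} \<in> edges G
          then (\<phi> u = \<phi> v \<and> \<phi> u \<in> VB K) \<or> {\<phi> u, \<phi> v} \<in> EB K \<union> EG K
          else (\<phi> u = \<phi> v \<and> \<phi> u \<in> VW K) \<or> {\<phi> u, \<phi> v} \<in> EW K \<union> EG K)"
    using assms(2) unfolding maps_to_def by meson
  show ?thesis
    unfolding maps_to_def
  proof (intro exI[of _ "\<phi> \<circ> f"] conjI ballI impI)
    show "(\<phi> \<circ> f) ` verts F \<subseteq> crg_verts K"
      using f(2) \<phi>(1) by auto
    fix u v assume uv: "u \<in> verts F" "v \<in> verts F" "u \<noteq> v"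
    have "f u \<in> verts G" "f v \<in> verts G" "f u \<noteq> f v"
      using f(1,2) uv by (auto dest: inj_onD)
    from \<phi>(2)[OF this] f(3)[OF uv(1,2)]
    show "if {u, v} \<in> edges F
          then ((\<phi> \<circ> f) u = (\<phi> \<circ> f) v \<and> (\<phi> \<circ> f) u \<in> VB K) \<or>
               {(\<phi> \<circ> f) u, (\<phi> \<circ> f) v} \<in> EB K \<union> EG K
          else ((\<phi> \<circ> f) u = (\<phi> \<circ> f) v \<and> (\<phi> \<circ> f) u \<in> VW K) \<or>
               {(\<phi> \<circ> f) u, (\<phi> \<circ> f) v} \<in> EW K \<union> EG K"
      unfolding o_apply by metis
  qed
qed

lemma family_maps_to_Forb_eq:
  assumes "\<forall>F\<in>\<F>. is_graph F" "Forb \<F> = Forb \<F>'" "family_maps_to \<F> K"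
  shows "family_maps_to \<F>' K"
proof -
  obtain F where F: "F \<in> \<F>" "maps_to F K"
    using assms(3) unfolding family_maps_to_def by blast
  have "F \<notin> Forb \<F>"
    using F(1) induced_subgraph_refl unfolding Forb_def by blast
  then have "F \<notin> Forb \<F>'"
    using assms(2) by simp
  then obtain F' where "F' \<in> \<F>'" "induced_subgraph F' F"
    using assms(1) F(1) unfolding Forb_def by blast
  then show ?thesis
    using F(2) maps_to_induced_subgraph unfolding family_maps_to_def by blast
qed

lemma crgs_Forb:
  assumes "\<forall>F\<in>\<F>. is_graph F"
  shows "crgs (Forb \<F>) = {K. is_crg K \<and> \<not> family_maps_to \<F> K}"
  unfolding crgs_def using assms family_maps_to_Forb_eq by fastforce

lemma is_graph_complete_bipartite: "is_graph (complete_bipartite s t)"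
  by (auto simp: is_graph_def complete_bipartite_def pairs_def card_2_iff)
    (metis le_antisym less_or_eq_imp_le not_less)

lemma compact_masses:
  assumes "finite (crg_verts K)"
  shows "compact (masses K)"
proof -
  let ?B = "PiE UNIV (\<lambda>x. if x \<in> crg_verts K then {0..1::real} else {0})"
  have B: "compact ?B"
  proof -
    have "compactin (product_topology (\<lambda>_. euclidean) UNIV) ?B"
      unfolding compactin_PiE by (auto simp: compactin_euclidean_iff)
    then show ?thesis
      by (simp add: euclidean_product_topology compactin_euclidean_iff)
  qed
  have C: "closed {\<mu> :: 'a \<Rightarrow> real. (\<Sum>x\<in>crg_verts K. \<mu> x) = 1}"
    by (intro closed_Collect_eq continuous_intros continuous_on_product_coordinates)
  have "masses K = ?B \<inter> {\<mu>. (\<Sum>x\<in>crg_verts K. \<mu> x) = 1}"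
  proof (intro equalityI subsetI IntI)
    fix \<mu> assume \<mu>: "\<mu> \<in> masses K"
    have "\<mu> x \<le> 1" if "x \<in> crg_verts K" for x
      using member_le_sum[of x "crg_verts K" \<mu>] that \<mu> assms by (auto simp: masses_def)
    then show "\<mu> \<in> ?B"
      using \<mu> by (auto simp: masses_def PiE_def extensional_def)
    show "\<mu> \<in> {\<mu>. (\<Sum>x\<in>crg_verts K. \<mu> x) = 1}"
      using \<mu> by (simp add: masses_def)
  next
    fix \<mu> assume \<mu>: "\<mu> \<in> ?B \<inter> {\<mu>. (\<Sum>x\<in>crg_verts K. \<mu> x) = 1}"
    then have "\<mu> x \<in> (if x \<in> crg_verts K then {0..1} else {0})" for x
      by blast
    then have "0 \<le> \<mu> x" "x \<notin> crg_verts K \<Longrightarrow> \<mu> x = 0" for x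
      by (metis atLeastAtMost_iff order_refl singletonD, metis singletonD)
    then show "\<mu> \<in> masses K"
      using \<mu> by (simp add: masses_def)
  qed
  then show ?thesis
    using B C by (simp add: compact_Int_closed)
qed

lemma crg_g_attained:
  assumes "is_crg K"
  obtains \<mu> where "\<mu> \<in> masses K" "crg_g K p = crg_form K p \<mu>"
    "\<And>\<nu>. \<nu> \<in> masses K \<Longrightarrow> crg_g K p \<le> crg_form K p \<nu>"
proof -
  have fin: "finite (crg_verts K)"
    using assms by (simp add: is_crg_def)
  obtain x where x: "x \<in> crg_verts K"
    using assms by (auto simp: is_crg_def)
  then have "(\<lambda>y. if y = x then 1 else 0) \<in> masses K"
    using fin by (auto simp: masses_def)
  moreover have "continuous_on (masses K) (crg_form K p)"
    unfolding crg_form_def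
    by (intro continuous_intros continuous_on_subset[OF continuous_on_product_coordinates]) auto
  ultimately obtain \<mu> where \<mu>: "\<mu> \<in> masses K"
    "\<forall>\<nu>\<in>masses K. crg_form K p \<mu> \<le> crg_form K p \<nu>"
    using continuous_attains_inf[OF compact_masses[OF fin]] by blast
  then have "crg_g K p = crg_form K p \<mu>"
    unfolding crg_g_def by (intro cInf_eq_minimum) auto
  then show ?thesis
    using that \<mu> by simp
qed

end

theory Submission
  imports Defs "HOL-Algebra.Algebraic_Closure_Type" "HOL-Library.Z2"
begin

text \<open>
  Put \<open>s = 1\<close> for \<open>K\<^bsub>2,t\<^esub>\<close> and \<open>s = 2\<close> for \<open>K\<^bsub>3,3\<^esub>\<close>. Near zero the value
  \<open>p - s p\<^sup>2\<close> separates what a single CRG can achieve from the edit distance function.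

  \<^bold>\<open>A fixed CRG is no better than \<open>p - s p\<^sup>2\<close>.\<close> Let \<open>K\<close> be a CRG to which
  \<open>K\<^bsub>s+1,t\<^esub>\<close> does not map. No gray edge joins two white vertices, so white mass \<open>W\<close>
  costs at least \<open>p W\<^sup>2\<close>. Mass can be saved only by moving it to black vertices with a gray edge to
  a white one, and no \<open>s + 1\<close> black vertices with gray edges to the same white vertex have pairwise
  non-black edges. By the weighted Turan inequality, mass \<open>m\<close> on such vertices costs at least
  \<open>(1 - p) m\<^sup>2 / s\<close>. The remaining black mass is shared by boundedly many vertices, each of which
  costs \<open>1 - p\<close> times the square of its mass, and this does not pay when \<open>p\<close> is small compared with
  \<open>1 / |K|\<close>. Minimising \<open>p (1 - m)\<^sup>2 + m\<^sup>2 / s\<close> over \<open>m\<close> gives \<open>p - s p\<^sup>2\<close> up to higher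
  order terms, and \<open>crg_form_ge_near_zero\<close> is the exact form of this. A finite set of CRGs therefore
  stays above \<open>p - s p\<^sup>2\<close> on some interval \<open>(0, \<delta>)\<close>.

  \<^bold>\<open>The edit distance function drops below \<open>p - s p\<^sup>2\<close> arbitrarily close to zero.\<close>
  Random recolouring along a CRG bounds \<open>ed\<close> by the value of its quadratic form
  (\<open>ed_Forb_le_crg_form\<close>). The CRGs used here have only black vertices: the gray edges form a
  \<open>d\<close>-regular graph \<open>\<Gamma>\<close> on \<open>k\<close> vertices, and the other edges are white. The uniform mass has the
  value \<open>p - (p (d + 2) - 1) / k\<close>, which is \<open>p - 1 / k\<close> at \<open>p = 2 / (d + 2)\<close>. This beats
  \<open>p - s p\<^sup>2\<close> as soon as \<open>(d + 2)\<^sup>2 > 4 s k\<close>. So \<open>\<Gamma>\<close> must have degree of order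
  \<open>\<surd>k\<close>, but must contain neither the forbidden graph nor what arises from it by contracting a
  matching (the parts of a map into black vertices are cliques of the forbidden graph).

  \<^bold>\<open>Dense graphs with few common neighbours.\<close> Let \<open>E\<close> be the field with \<open>Q = 2\<^sup>n\<close>
  elements, \<open>Q - 1 = r c\<close>, and let \<open>P\<close> be the group of \<open>r\<close>-th roots of unity. On \<open>E \<times> P\<close> join
  \<open>(A, a)\<close> and \<open>(B, b)\<close> if \<open>(A + B)\<^sup>c = a b\<close>. This graph is \<open>(Q - 1)\<close>-regular on at most
  \<open>Q (Q - 1) / c\<close> vertices, and two vertices have at most \<open>c\<close> common neighbours. For \<open>K\<^bsub>2,t\<^esub>\<close>
  the choice \<open>c = 5\<close> and \<open>Q = 16\<^sup>n\<close> is dense enough. For \<open>K\<^bsub>3,3\<^esub>\<close> take \<open>Q = q\<^sup>2\<close>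
  and \<open>c = q + 1\<close>, so that \<open>x\<^sup>c\<close> is the norm of the quadratic extension and the graph is the
  projective norm graph of Alon, Ronyai and Szabo. Three of its vertices have at most two common
  neighbours. Contracting a non-empty matching of \<open>K\<^bsub>3,3\<^esub>\<close> creates a triangle, so passing to
  the bipartite double cover excludes the contractions as well. Working in characteristic two
  makes these graphs loopless, and all the fields \<open>E\<close> live inside one type, the algebraic closure
  of the field with two elements.
\<close>

section \<open>Editing a graph along a CRG\<close>

text \<open>A cell is the image of an edge under a colouring of the vertices by vertices of the CRG: a
  singleton if both ends have the same colour, a pair otherwise. Treating both kinds uniformly avoids
  a case distinction at every edge.\<close>

definition white_cells :: "'a crg \<Rightarrow> 'a set set" where
  "white_cells K = EW K \<union> {{x} | x. x \<in> VW K}"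

definition black_cells :: "'a crg \<Rightarrow> 'a set set" where
  "black_cells K = EB K \<union> {{x} | x. x \<in> VB K}"

definition edit_along :: "'b crg \<Rightarrow> ('a \<Rightarrow> 'b) \<Rightarrow> 'a graph \<Rightarrow> 'a graph" where
  "edit_along K \<phi> G = \<lparr>verts = verts G,
     edges = {e \<in> pairs (verts G).
       if e \<in> edges G then \<phi> ` e \<notin> white_cells K else \<phi> ` e \<in> black_cells K}\<rparr>"

lemma finite_pairs: "finite V \<Longrightarrow> finite (pairs V)"
  unfolding pairs_def by (rule finite_subset[of _ "Pow V"]) auto

lemma card_pairs: "finite V \<Longrightarrow> card (pairs V) = card V choose 2"
  unfolding pairs_def using n_subsets by auto

lemma pair_in_pairs_iff: "{u, v} \<in> pairs V \<longleftrightarrow> u \<in> V \<and> v \<in> V \<and> u \<noteq> v"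
  by (auto simp: pairs_def card_2_iff doubleton_eq_iff)

lemma pairsE:
  assumes "e \<in> pairs V"
  obtains u v where "e = {u, v}" "u \<in> V" "v \<in> V" "u \<noteq> v"
  using assms by (auto simp: pairs_def card_2_iff)

lemma crg_edges_pairs:
  assumes "is_crg K"
  shows "EB K \<subseteq> pairs (crg_verts K)" "EW K \<subseteq> pairs (crg_verts K)" "EG K \<subseteq> pairs (crg_verts K)"
  using assms by (auto simp: is_crg_def)

lemma singleton_notin_crg_edges:
  assumes "is_crg K"
  shows "{x} \<notin> EB K" "{x} \<notin> EW K" "{x} \<notin> EG K"
  using crg_edges_pairs[OF assms] by (auto simp: pairs_def)

lemma pair_in_white_cells_iff:
  "is_crg K \<Longrightarrow> {x, y} \<in> white_cells K \<longleftrightarrow> (x = y \<and> x \<in> VW K) \<or> {x, y} \<in> EW K"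
  by (auto simp: white_cells_def)

lemma pair_in_black_cells_iff:
  "is_crg K \<Longrightarrow> {x, y} \<in> black_cells K \<longleftrightarrow> (x = y \<and> x \<in> VB K) \<or> {x, y} \<in> EB K"
  by (auto simp: black_cells_def)

lemma crg_matrix_eq:
  assumes "is_crg K"
  shows "crg_matrix K p x y =
    p * of_bool ({x, y} \<in> white_cells K) + (1 - p) * of_bool ({x, y} \<in> black_cells K)"
proof -
  have "VB K \<inter> VW K = {}" "EB K \<inter> EW K = {}"
    using assms by (auto simp: is_crg_def)
  then show ?thesis
    using singleton_notin_crg_edges[OF assms]
    by (auto simp: crg_matrix_def pair_in_white_cells_iff[OF assms]
        pair_in_black_cells_iff[OF assms])
qed

lemma crg_matrix_nonneg:
  assumes "0 \<le> p" "p \<le> 1"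
  shows "0 \<le> crg_matrix K p x y"
  using assms by (simp add: crg_matrix_def)

lemma is_graph_edit_along: "is_graph G \<Longrightarrow> is_graph (edit_along K \<phi> G)"
  by (auto simp: is_graph_def edit_along_def)

lemma crg_pair_cases:
  assumes "is_crg K" "x \<in> crg_verts K" "y \<in> crg_verts K"
  shows "{x, y} \<in> white_cells K \<or> {x, y} \<in> black_cells K \<or> {x, y} \<in> EG K"
proof (cases "x = y")
  case True
  then show ?thesis
    using assms by (auto simp: crg_verts_def white_cells_def black_cells_def)
next
  case False
  then have "{x, y} \<in> pairs (crg_verts K)"
    using assms by (simp add: pair_in_pairs_iff)
  then show ?thesis
    using assms(1) by (auto simp: is_crg_def white_cells_def black_cells_def)
qed

text \<open>After the edit every edge has a black or gray cell and every non-edge a white or gray one, so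
  a copy of \<open>F\<close> followed by the colouring is a map of \<open>F\<close> to the CRG.\<close>

lemma edit_along_not_contains:
  assumes K: "is_crg K" and G: "is_graph G" and \<phi>: "\<phi> ` verts G \<subseteq> crg_verts K"
    and F: "\<not> maps_to F K"
  shows "\<not> induced_subgraph F (edit_along K \<phi> G)"
proof
  assume "induced_subgraph F (edit_along K \<phi> G)"
  then obtain f where f: "inj_on f (verts F)" "f ` verts F \<subseteq> verts G"
    "\<And>u v. u \<in> verts F \<Longrightarrow> v \<in> verts F \<Longrightarrow>
       {u, v} \<in> edges F \<longleftrightarrow> {f u, f v} \<in> edges (edit_along K \<phi> G)"
    unfolding induced_subgraph_def by (auto simp: edit_along_def)
  have "maps_to F K"
    unfolding maps_to_def
  proof (intro exI[of _ "\<phi> \<circ> f"] conjI ballI impI)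
    show "(\<phi> \<circ> f) ` verts F \<subseteq> crg_verts K"
      using f(2) \<phi> by auto
    fix u v assume uv: "u \<in> verts F" "v \<in> verts F" "u \<noteq> v"
    have fuv: "f u \<in> verts G" "f v \<in> verts G" "f u \<noteq> f v"
      using f(1,2) uv by (auto dest: inj_onD)
    then have P: "{f u, f v} \<in> pairs (verts G)"
      by (simp add: pair_in_pairs_iff)
    have C: "\<phi> (f u) \<in> crg_verts K" "\<phi> (f v) \<in> crg_verts K"
      using fuv \<phi> by auto
    have disj: "white_cells K \<inter> black_cells K = {}"
      using K singleton_notin_crg_edges[OF K]
      by (auto simp: is_crg_def white_cells_def black_cells_def)
    show "if {u, v} \<in> edges F
          then ((\<phi> \<circ> f) u = (\<phi> \<circ> f) v \<and> (\<phi> \<circ> f) u \<in> VB K) \<or>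
               {(\<phi> \<circ> f) u, (\<phi> \<circ> f) v} \<in> EB K \<union> EG K
          else ((\<phi> \<circ> f) u = (\<phi> \<circ> f) v \<and> (\<phi> \<circ> f) u \<in> VW K) \<or>
               {(\<phi> \<circ> f) u, (\<phi> \<circ> f) v} \<in> EW K \<union> EG K"
      using f(3)[OF uv(1,2)] P crg_pair_cases[OF K C] disj
      by (auto simp: edit_along_def pair_in_white_cells_iff[OF K] pair_in_black_cells_iff[OF K]
          split: if_splits)
  qed
  with F show False by simp
qed

lemma sum_of_bool_card: "finite A \<Longrightarrow> (\<Sum>x\<in>A. of_bool (P x) :: real) = real (card {x \<in> A. P x})"
  by (simp add: sum.If_cases of_bool_def Collect_conj_eq)

lemma card_edits:
  fixes K :: "'b crg" and \<phi> :: "'a \<Rightarrow> 'b"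
  assumes "is_graph G"
  defines "H \<equiv> edit_along K \<phi> G"
  shows "real (card ((edges G - edges H) \<union> (edges H - edges G))) =
    (\<Sum>e\<in>edges G. of_bool (\<phi> ` e \<in> white_cells K)) +
    (\<Sum>e\<in>pairs (verts G) - edges G. of_bool (\<phi> ` e \<in> black_cells K))"
proof -
  have sub: "edges G \<subseteq> pairs (verts G)" and fin: "finite (pairs (verts G))"
    using assms finite_pairs by (auto simp: is_graph_def)
  have "edges G - edges H = {e \<in> edges G. \<phi> ` e \<in> white_cells K}"
    "edges H - edges G = {e \<in> pairs (verts G) - edges G. \<phi> ` e \<in> black_cells K}"
    using sub by (auto simp: H_def edit_along_def)
  moreover have "real (card ((edges G - edges H) \<union> (edges H - edges G))) =
      real (card (edges G - edges H)) + real (card (edges H - edges G))"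
    using sub fin by (subst card_Un_disjoint) (auto simp: H_def edit_along_def intro: finite_subset)
  moreover have "finite (edges G)"
    using sub fin by (rule finite_subset)
  ultimately show ?thesis
    using fin by (simp add: sum_of_bool_card del: sum_of_bool_eq)
qed

section \<open>Random colourings\<close>

text \<open>The colours of two distinct vertices are independent with distribution \<open>\<mu>\<close> when all
  vertices are coloured independently; the product over \<open>V\<close> is the probability of the colouring
  \<open>\<phi>\<close>.\<close>

lemma sum_prod_weight_pair:
  fixes \<mu> :: "'b \<Rightarrow> real"
  assumes V: "finite V" "u \<in> V" "v \<in> V" "u \<noteq> v" and C: "finite C" "sum \<mu> C = 1"
  shows "(\<Sum>\<phi>\<in>V \<rightarrow>\<^sub>E C. (\<Prod>w\<in>V. \<mu> (\<phi> w)) * h (\<phi> u) (\<phi> v)) =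
    (\<Sum>x\<in>C. \<Sum>y\<in>C. \<mu> x * (h x y * \<mu> y))"
proof -
  have fin: "finite (V \<rightarrow>\<^sub>E C)"
    using V C by (simp add: finite_PiE)
  \<comment> \<open>The indicators of \<open>\<phi> u = x\<close> and \<open>\<phi> v = y\<close> go into the factors of \<open>u\<close> and \<open>v\<close>, so that the
    sum over all \<open>\<phi>\<close> factorises.\<close>
  define f where "f x y w z = \<mu> z * (if w = u then of_bool (z = x) else 1) *
      (if w = v then of_bool (z = y) else 1)" for x y z and w :: 'a
  have joint: "(\<Sum>\<phi>\<in>V \<rightarrow>\<^sub>E C. (\<Prod>w\<in>V. \<mu> (\<phi> w)) * of_bool (\<phi> u = x) * of_bool (\<phi> v = y)) = \<mu> x * \<mu> y"
    if xy: "x \<in> C" "y \<in> C" for x y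
  proof -
    have "(\<Sum>\<phi>\<in>V \<rightarrow>\<^sub>E C. (\<Prod>w\<in>V. \<mu> (\<phi> w)) * of_bool (\<phi> u = x) * of_bool (\<phi> v = y)) =
        (\<Sum>\<phi>\<in>V \<rightarrow>\<^sub>E C. \<Prod>w\<in>V. f x y w (\<phi> w))"
      using V by (intro sum.cong) (simp_all add: f_def prod.distrib)
    also have "\<dots> = (\<Prod>w\<in>V. \<Sum>z\<in>C. f x y w z)"
      using V C by (subst prod_sum_PiE) auto
    also have "\<dots> = (\<Prod>w\<in>V. (if w = u then \<mu> x else 1) * (if w = v then \<mu> y else 1))"
    proof (intro prod.cong refl)
      fix w
      have "(\<Sum>z\<in>C. \<mu> z * of_bool (z = x')) = \<mu> x'" if "x' \<in> C" for x'
        using C that by (simp add: of_bool_def if_distrib sum.delta cong: if_cong)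
      then show "(\<Sum>z\<in>C. f x y w z) = (if w = u then \<mu> x else 1) * (if w = v then \<mu> y else 1)"
        using V C xy by (simp add: f_def)
    qed
    also have "\<dots> = \<mu> x * \<mu> y"
      using V by (simp add: prod.distrib)
    finally show ?thesis .
  qed
  have "(\<Sum>\<phi>\<in>V \<rightarrow>\<^sub>E C. (\<Prod>w\<in>V. \<mu> (\<phi> w)) * h (\<phi> u) (\<phi> v)) =
      (\<Sum>\<phi>\<in>V \<rightarrow>\<^sub>E C. \<Sum>x\<in>C. \<Sum>y\<in>C.
        h x y * ((\<Prod>w\<in>V. \<mu> (\<phi> w)) * of_bool (\<phi> u = x) * of_bool (\<phi> v = y)))"
  proof (intro sum.cong refl)
    fix \<phi> assume "\<phi> \<in> V \<rightarrow>\<^sub>E C"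
    then have in_X: "\<phi> u \<in> C" "\<phi> v \<in> C"
      using V by auto
    have "(\<Sum>x\<in>C. \<Sum>y\<in>C.
        h x y * ((\<Prod>w\<in>V. \<mu> (\<phi> w)) * of_bool (\<phi> u = x) * of_bool (\<phi> v = y))) =
      (\<Sum>x\<in>C. if \<phi> u = x then (\<Sum>y\<in>C. if \<phi> v = y then (\<Prod>w\<in>V. \<mu> (\<phi> w)) * h x y else 0) else 0)"
      by (intro sum.cong refl) (auto intro!: sum.cong)
    also have "\<dots> = (\<Prod>w\<in>V. \<mu> (\<phi> w)) * h (\<phi> u) (\<phi> v)"
      using in_X C by simp
    finally show "(\<Prod>w\<in>V. \<mu> (\<phi> w)) * h (\<phi> u) (\<phi> v) = (\<Sum>x\<in>C. \<Sum>y\<in>C.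
        h x y * ((\<Prod>w\<in>V. \<mu> (\<phi> w)) * of_bool (\<phi> u = x) * of_bool (\<phi> v = y)))" ..
  qed
  also have "\<dots> = (\<Sum>x\<in>C. \<Sum>y\<in>C. h x y * (\<Sum>\<phi>\<in>V \<rightarrow>\<^sub>E C.
        (\<Prod>w\<in>V. \<mu> (\<phi> w)) * of_bool (\<phi> u = x) * of_bool (\<phi> v = y)))"
    by (simp add: sum_distrib_left sum.swap[of _ _ "V \<rightarrow>\<^sub>E C"])
  also have "\<dots> = (\<Sum>x\<in>C. \<Sum>y\<in>C. \<mu> x * (h x y * \<mu> y))"
    by (intro sum.cong refl) (simp add: joint)
  finally show ?thesis .
qed

lemma ex_le_weighted_average:
  fixes w f :: "'a \<Rightarrow> real"
  assumes "finite A" "\<And>x. x \<in> A \<Longrightarrow> 0 \<le> w x" "sum w A = 1" "(\<Sum>x\<in>A. w x * f x) \<le> c"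
  shows "\<exists>x\<in>A. f x \<le> c"
proof (rule ccontr)
  assume "\<not> ?thesis"
  then have less: "c < f x" if "x \<in> A" for x
    using that by force
  obtain y where y: "y \<in> A" "w y > 0"
    using assms(2,3) by (metis less_eq_real_def sum.neutral zero_neq_one)
  have "(\<Sum>x\<in>A. w x * c) < (\<Sum>x\<in>A. w x * f x)"
  proof (rule sum_strict_mono_ex1)
    show "\<forall>x\<in>A. w x * c \<le> w x * f x"
      using assms(2) less by (simp add: mult_left_mono less_imp_le)
    show "\<exists>x\<in>A. w x * c < w x * f x"
      using less y by (intro bexI[of _ y]) auto
  qed (fact assms(1))
  then show False
    using assms(3,4) by (simp flip: sum_distrib_right)
qed

text \<open>A random colouring edits an edge with the probability that its cell is white, and a non-edge
  with the probability that its cell is black. As \<open>G\<close> has density \<open>p\<close> up to rounding, the expected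
  number of edits is the quadratic form up to the rounding error, and some colouring does as well as
  the average.\<close>

lemma ex_edit_along_le:
  assumes K: "is_crg K" and \<mu>: "\<mu> \<in> masses K" and G: "is_graph G" and p: "0 \<le> p" "p \<le> 1"
    and e: "int (card (edges G)) = \<lfloor>p * real (card (verts G) choose 2)\<rfloor>"
  obtains \<phi> where "\<phi> ` verts G \<subseteq> crg_verts K"
    "edit_dist G (edit_along K \<phi> G) \<le> crg_form K p \<mu> + 1 / real (card (verts G) choose 2)"
proof -
  define V C N where "V = verts G" and "C = crg_verts K" and "N = card V choose 2"
  have fin: "finite V" "finite C"
    using G K by (auto simp: is_graph_def is_crg_def V_def C_def)
  have sub: "edges G \<subseteq> pairs V"
    using G by (simp add: is_graph_def V_def)
  have \<mu>': "\<And>x. 0 \<le> \<mu> x" "sum \<mu> C = 1"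
    using \<mu> by (auto simp: masses_def C_def)
  define mass where "mass S = (\<Sum>x\<in>C. \<Sum>y\<in>C. \<mu> x * (of_bool ({x, y} \<in> S) * \<mu> y))" for S
  define wt where "wt \<phi> = (\<Prod>v\<in>V. \<mu> (\<phi> v))" for \<phi>
  define edits where "edits \<phi> = (\<Sum>e\<in>edges G. of_bool (\<phi> ` e \<in> white_cells K)) +
    (\<Sum>e\<in>pairs V - edges G. of_bool (\<phi> ` e \<in> black_cells K) :: real)" for \<phi>
  have form: "crg_form K p \<mu> = p * mass (white_cells K) + (1 - p) * mass (black_cells K)"
    by (simp add: crg_form_def crg_matrix_eq[OF K] mass_def C_def[symmetric]
        sum_distrib_left algebra_simps flip: sum.distrib)
  have avg: "(\<Sum>\<phi>\<in>V \<rightarrow>\<^sub>E C. wt \<phi> * of_bool (\<phi> ` e \<in> S)) = mass S" if e: "e \<in> pairs V" for e S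
  proof -
    obtain u v where "e = {u, v}" "u \<in> V" "v \<in> V" "u \<noteq> v"
      using e by (rule pairsE)
    then show ?thesis
      using sum_prod_weight_pair[of V u v C \<mu> "\<lambda>x y. of_bool ({x, y} \<in> S)"] fin \<mu>'
      by (simp add: wt_def mass_def)
  qed
  have "(\<Sum>\<phi>\<in>V \<rightarrow>\<^sub>E C. wt \<phi> * edits \<phi>) =
      (\<Sum>e\<in>edges G. \<Sum>\<phi>\<in>V \<rightarrow>\<^sub>E C. wt \<phi> * of_bool (\<phi> ` e \<in> white_cells K)) +
      (\<Sum>e\<in>pairs V - edges G. \<Sum>\<phi>\<in>V \<rightarrow>\<^sub>E C. wt \<phi> * of_bool (\<phi> ` e \<in> black_cells K))"
    by (simp only: edits_def distrib_left sum_distrib_left sum.distrib sum.swap[of _ _ "V \<rightarrow>\<^sub>E C"])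
  also have "\<dots> = (\<Sum>e\<in>edges G. mass (white_cells K)) +
      (\<Sum>e\<in>pairs V - edges G. mass (black_cells K))"
    using sub by (intro arg_cong2[of _ _ _ _ "(+)"] sum.cong refl avg) auto
  also have "\<dots> = card (edges G) * mass (white_cells K) +
      (N - card (edges G)) * mass (black_cells K)"
    using sub fin by (simp add: card_Diff_subset finite_subset[OF sub] finite_pairs card_pairs N_def)
  also have "\<dots> \<le> N * crg_form K p \<mu> + 1"
  proof -
    have nonneg: "0 \<le> mass S" for S
      unfolding mass_def using \<mu>' by (intro sum_nonneg) auto
    have le1: "mass S \<le> 1" for S
    proof -
      have "mass S \<le> (\<Sum>x\<in>C. \<Sum>y\<in>C. \<mu> x * \<mu> y)"
        unfolding mass_def using \<mu>' by (intro sum_mono) auto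
      also have "\<dots> = 1"
        using \<mu>' by (simp flip: sum_distrib_left)
      finally show ?thesis .
    qed
    \<comment> \<open>Rounding down the number of edges turns at most one edge into a non-edge; this is the
      extra \<open>1\<close>.\<close>
    have eN: "real (card (edges G)) \<le> p * N" "p * N - 1 \<le> card (edges G)"
      using e by (simp_all add: N_def V_def) linarith+
    have leN: "card (edges G) \<le> N"
      unfolding N_def using sub fin by (metis card_mono card_pairs finite_pairs)
    have "card (edges G) * mass (white_cells K) \<le> p * N * mass (white_cells K)"
      using eN nonneg by (intro mult_right_mono) auto
    moreover have "(N - card (edges G)) * mass (black_cells K) \<le>
        ((1 - p) * N + 1) * mass (black_cells K)"
      using eN nonneg leN by (intro mult_right_mono) (auto simp: algebra_simps of_nat_diff)
    ultimately show ?thesis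
      using le1[of "black_cells K"] unfolding form by (simp add: algebra_simps)
  qed
  finally have "(\<Sum>\<phi>\<in>V \<rightarrow>\<^sub>E C. wt \<phi> * edits \<phi>) \<le> N * crg_form K p \<mu> + 1" .
  moreover have "sum wt (V \<rightarrow>\<^sub>E C) = 1"
    unfolding wt_def using prod_sum_PiE[of V "\<lambda>_. C" "\<lambda>_. \<mu>"] fin \<mu>' by simp
  moreover have "finite (V \<rightarrow>\<^sub>E C)" "\<And>\<phi>. 0 \<le> wt \<phi>"
    using fin \<mu>' by (auto simp: wt_def finite_PiE prod_nonneg)
  ultimately obtain \<phi> where \<phi>: "\<phi> \<in> V \<rightarrow>\<^sub>E C" "edits \<phi> \<le> N * crg_form K p \<mu> + 1"
    using ex_le_weighted_average[of "V \<rightarrow>\<^sub>E C" wt edits] by blast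
  show thesis
  proof (rule that[of \<phi>])
    show "\<phi> ` verts G \<subseteq> crg_verts K"
      using \<phi>(1) by (auto simp: V_def C_def)
    have form_nonneg: "0 \<le> crg_form K p \<mu>"
      unfolding crg_form_def using \<mu>' p by (intro sum_nonneg) (auto simp: crg_matrix_nonneg)
    have "edit_dist G (edit_along K \<phi> G) = edits \<phi> / N"
      by (simp add: edit_dist_def card_edits[OF G] edits_def N_def V_def)
    also have "\<dots> \<le> (N * crg_form K p \<mu> + 1) / N"
      using \<phi>(2) by (intro divide_right_mono) auto
    also have "\<dots> \<le> crg_form K p \<mu> + 1 / N"
      using form_nonneg by (cases "N = 0") (auto simp: add_divide_distrib)
    finally show "edit_dist G (edit_along K \<phi> G) \<le>
        crg_form K p \<mu> + 1 / real (card (verts G) choose 2)"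
      by (simp add: N_def V_def)
  qed
qed

text \<open>Membership in a finite set that depends only on the number of vertices is what makes the maximum
  over all graphs of that order meaningful.\<close>

lemma edit_dist_to_finite_range:
  assumes G: "is_graph G" and H: "H \<in> Forb \<F>" "verts H = verts G"
  shows "edit_dist_to G (Forb \<F>) \<le> edit_dist G H"
    and "edit_dist_to G (Forb \<F>) \<in>
      (\<lambda>i. real i / real (card (verts G) choose 2)) ` {..card (verts G) choose 2}"
proof -
  let ?N = "card (verts G) choose 2"
  let ?A = "{edit_dist G H | H. H \<in> Forb \<F> \<and> verts H = verts G}"
  have fin: "finite (verts G)" and sub: "edges G \<subseteq> pairs (verts G)"
    using G by (auto simp: is_graph_def)
  have sub_A: "?A \<subseteq> (\<lambda>i. real i / real ?N) ` {..?N}"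
  proof
    fix d assume "d \<in> ?A"
    then obtain H where H: "d = edit_dist G H" "is_graph H" "verts H = verts G"
      by (auto simp: Forb_def)
    have "card ((edges G - edges H) \<union> (edges H - edges G)) \<le> card (pairs (verts G))"
      using H sub fin by (intro card_mono finite_pairs) (auto simp: is_graph_def)
    then show "d \<in> (\<lambda>i. real i / real ?N) ` {..?N}"
      using fin by (auto simp: H(1) edit_dist_def card_pairs)
  qed
  then have fin_A: "finite ?A"
    by (rule finite_subset) simp
  show "edit_dist_to G (Forb \<F>) \<le> edit_dist G H"
    unfolding edit_dist_to_def using H by (intro Min_le fin_A) auto
  have "Min ?A \<in> ?A"
    using fin_A H by (intro Min_in) auto
  then show "edit_dist_to G (Forb \<F>) \<in> (\<lambda>i. real i / real ?N) ` {..?N}"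
    unfolding edit_dist_to_def using sub_A by blast
qed

lemma ex_graph_card_edges:
  assumes "m \<le> n choose 2"
  obtains G :: "nat graph" where "is_graph G" "card (verts G) = n" "card (edges G) = m"
proof -
  have "m \<le> card (pairs {..<n})"
    using assms by (simp add: card_pairs)
  then obtain E where "E \<subseteq> pairs {..<n}" "card E = m"
    by (meson obtain_subset_with_card_n)
  then show thesis
    by (intro that[of "\<lparr>verts = {..<n}, edges = E\<rparr>"]) (auto simp: is_graph_def)
qed

text \<open>The easy inequality of the Balogh-Martin theorem. The rounding error of a graph on \<open>n\<close>
  vertices is one edit, which is lost in the limit.\<close>

lemma ed_Forb_le_crg_form:
  assumes K: "is_crg K" "\<not> family_maps_to \<F> K" and \<mu>: "\<mu> \<in> masses K" and p: "0 \<le> p" "p \<le> 1"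
  shows "ed (Forb \<F>) p \<le> crg_form K p \<mu>"
proof -
  have bound: "max_edit_dist (Forb \<F>) p n \<le> crg_form K p \<mu> + 1 / real (n choose 2)" for n
  proof -
    let ?N = "n choose 2"
    let ?\<G> = "{G :: nat graph. is_graph G \<and> card (verts G) = n \<and>
            int (card (edges G)) = \<lfloor>p * real ?N\<rfloor>}"
    let ?A = "{edit_dist_to G (Forb \<F>) | G. is_graph G \<and> card (verts G) = n \<and>
            int (card (edges G)) = \<lfloor>p * real ?N\<rfloor>}"
    have dist: "edit_dist_to G (Forb \<F>) \<le> crg_form K p \<mu> + 1 / real ?N \<and>
        edit_dist_to G (Forb \<F>) \<in> (\<lambda>i. real i / real ?N) ` {..?N}" if G: "G \<in> ?\<G>" for G
    proof -
      obtain \<phi> where \<phi>: "\<phi> ` verts G \<subseteq> crg_verts K"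
        "edit_dist G (edit_along K \<phi> G) \<le> crg_form K p \<mu> + 1 / real ?N"
        using ex_edit_along_le[OF K(1) \<mu> _ p, of G] G by auto
      have "edit_along K \<phi> G \<in> Forb \<F>"
        using G K \<phi>(1) edit_along_not_contains is_graph_edit_along
        unfolding Forb_def family_maps_to_def by blast
      then show ?thesis
        using edit_dist_to_finite_range[of G "edit_along K \<phi> G" \<F>] G \<phi>(2)
        by (auto simp: edit_along_def)
    qed
    have "nat \<lfloor>p * real ?N\<rfloor> \<le> ?N"
    proof -
      have "p * real ?N \<le> real ?N"
        using p mult_right_mono[of p 1 "real ?N"] by simp
      then show ?thesis by linarith
    qed
    then obtain G\<^sub>0 :: "nat graph" where "is_graph G\<^sub>0" "card (verts G\<^sub>0) = n" "card (edges G\<^sub>0) = nat \<lfloor>p * real ?N\<rfloor>"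
      by (rule ex_graph_card_edges)
    then have "G\<^sub>0 \<in> ?\<G>"
      using p by simp
    then have "?A \<noteq> {}"
      by blast
    moreover have "?A \<subseteq> (\<lambda>i. real i / real ?N) ` {..?N}"
      using dist by blast
    then have "finite ?A"
      by (rule finite_subset) simp
    ultimately show ?thesis
      unfolding max_edit_dist_def using dist by (subst Max_le_iff) auto
  qed
  have lim: "(\<lambda>n. crg_form K p \<mu> + 1 / real (n choose 2)) \<longlonglongrightarrow> crg_form K p \<mu>"
  proof -
    have "(\<lambda>n. 1 / real (n choose 2)) \<longlonglongrightarrow> 0"
    proof (rule Lim_null_comparison[OF _ lim_inverse_n])
      show "\<forall>\<^sub>F n in sequentially. norm (1 / real (n choose 2)) \<le> inverse (of_nat n)"
      proof (rule eventually_sequentiallyI[of 3])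
        fix n :: nat assume n: "3 \<le> n"
        then have "n * 2 \<le> n * (n - 1)"
          by (intro mult_left_mono) auto
        then have "n * 2 div 2 \<le> n * (n - 1) div 2"
          by (rule div_le_mono)
        then have "n \<le> n choose 2"
          by (simp add: choose_two)
        then show "norm (1 / real (n choose 2)) \<le> inverse (of_nat n)"
          using n by (simp add: field_simps)
      qed
    qed
    then show ?thesis
      by (auto intro: tendsto_eq_intros)
  qed
  have "limsup (\<lambda>n. ereal (max_edit_dist (Forb \<F>) p n)) \<le>
      limsup (\<lambda>n. ereal (crg_form K p \<mu> + 1 / real (n choose 2)))"
    using bound by (intro Limsup_mono always_eventually) simp
  also have "\<dots> = ereal (crg_form K p \<mu>)"
    using lim by (intro lim_imp_Limsup) auto
  finally have "limsup (\<lambda>n. ereal (max_edit_dist (Forb \<F>) p n)) \<le> ereal (crg_form K p \<mu>)" .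
  moreover have "0 \<le> crg_form K p \<mu>"
    unfolding crg_form_def using \<mu> p
    by (intro sum_nonneg) (auto simp: crg_matrix_nonneg masses_def)
  ultimately show ?thesis
    unfolding ed_def by (cases "limsup (\<lambda>n. ereal (max_edit_dist (Forb \<F>) p n))") auto
qed

section \<open>Lower bound for a fixed CRG near zero\<close>

text \<open>The Motzkin-Straus form of Turan's theorem, for the complement of the graph \<open>R\<close>, which carries
  all loops. Remove the neighbourhood \<open>N\<close> of a vertex \<open>v\<close> of least weighted degree. What is left has
  no \<open>s\<close> pairwise unrelated vertices, since \<open>v\<close> could be added to them. The neighbourhood has mass
  \<open>deg v\<close>, and every vertex in it has degree at least \<open>deg v\<close>, so it contributes at least
  \<open>(deg v)\<^sup>2\<close>. Cauchy-Schwarz combines this with the induction hypothesis.\<close>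

lemma weighted_Turan:
  fixes \<mu> :: "'a \<Rightarrow> real"
  assumes "finite B" "\<And>x. x \<in> B \<Longrightarrow> 0 \<le> \<mu> x"
    and "\<And>x. x \<in> B \<Longrightarrow> R x x" "\<And>x y. R x y \<Longrightarrow> R y x"
    and "\<And>S. S \<subseteq> B \<Longrightarrow> card S = Suc s \<Longrightarrow> \<exists>x\<in>S. \<exists>y\<in>S. x \<noteq> y \<and> R x y"
  shows "(sum \<mu> B)\<^sup>2 \<le> real s * (\<Sum>x\<in>B. \<Sum>y\<in>{y \<in> B. R x y}. \<mu> x * \<mu> y)"
  using assms
proof (induction s arbitrary: B)
  case 0
  have "B = {}"
  proof (rule ccontr)
    assume "B \<noteq> {}"
    then obtain x where "x \<in> B" by blast
    with "0.prems"(5)[of "{x}"] show False by auto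
  qed
  then show ?case by simp
next
  case (Suc s)
  note prems = Suc.prems
  define deg where "deg x = sum \<mu> {y \<in> B. R x y}" for x
  show ?case
  proof (cases "B = {}")
    case False
    obtain v where v: "v \<in> B" "\<And>x. x \<in> B \<Longrightarrow> deg v \<le> deg x"
      using arg_min_if_finite[OF prems(1) False, of deg] not_less by blast
    define N B' where "N = {y \<in> B. R v y}" and "B' = B - N"
    have sub: "N \<subseteq> B" "B' \<subseteq> B" "finite N" "finite B'"
      using prems(1) by (auto simp: N_def B'_def)
    define q' where "q' = (\<Sum>x\<in>B'. \<Sum>y\<in>{y \<in> B'. R x y}. \<mu> x * \<mu> y)"
    have IH: "(sum \<mu> B')\<^sup>2 \<le> real s * q'"
      unfolding q'_def
    proof (rule Suc.IH)
      fix S assume S: "S \<subseteq> B'" "card S = Suc s"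
      then have fin: "finite S" and "v \<notin> S"
        using v(1) prems(3) card_ge_0_finite[of S] by (auto simp: B'_def N_def)
      then have "\<exists>x\<in>insert v S. \<exists>y\<in>insert v S. x \<noteq> y \<and> R x y"
        using S sub v(1) by (intro prems(5)) auto
      then obtain x y where xy: "x \<in> insert v S" "y \<in> insert v S" "x \<noteq> y" "R x y"
        by blast
      have "\<not> R v z" "\<not> R z v" if "z \<in> S" for z
        using that S(1) prems(4)[of z v] unfolding B'_def N_def by blast+
      then show "\<exists>x\<in>S. \<exists>y\<in>S. x \<noteq> y \<and> R x y"
        using xy by blast
    qed (use prems sub in auto)
    have deg_nonneg: "0 \<le> deg v"
      unfolding deg_def using prems(2) by (intro sum_nonneg) auto
    have q'_nonneg: "0 \<le> q'"
      unfolding q'_def using prems(2) sub by (intro sum_nonneg mult_nonneg_nonneg) auto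
    have "(\<Sum>x\<in>B. \<Sum>y\<in>{y \<in> B. R x y}. \<mu> x * \<mu> y) = (\<Sum>x\<in>B. \<mu> x * deg x)"
      by (simp add: deg_def sum_distrib_left)
    also have "\<dots> = (\<Sum>x\<in>B'. \<mu> x * deg x) + (\<Sum>x\<in>N. \<mu> x * deg x)"
      unfolding B'_def using sub prems(1) by (simp add: sum.subset_diff)
    also have "\<dots> \<ge> q' + deg v * deg v"
    proof (rule add_mono)
      show "q' \<le> (\<Sum>x\<in>B'. \<mu> x * deg x)"
        unfolding q'_def deg_def sum_distrib_left using prems(1,2) sub
        by (intro sum_mono sum_mono2) auto
      have "deg v * deg v = (\<Sum>x\<in>N. \<mu> x * deg v)"
        by (simp add: deg_def N_def sum_distrib_right)
      also have "\<dots> \<le> (\<Sum>x\<in>N. \<mu> x * deg x)"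
        using v(2) sub(1) prems(2) by (intro sum_mono mult_left_mono) auto
      finally show "deg v * deg v \<le> (\<Sum>x\<in>N. \<mu> x * deg x)" .
    qed
    finally have q: "(deg v)\<^sup>2 + q' \<le> (\<Sum>x\<in>B. \<Sum>y\<in>{y \<in> B. R x y}. \<mu> x * \<mu> y)"
      by (simp add: power2_eq_square)
    have total: "sum \<mu> B = sum \<mu> B' + deg v"
      using sum.subset_diff[OF sub(1) prems(1), of \<mu>] by (simp add: B'_def deg_def N_def)
    have "(sum \<mu> B)\<^sup>2 \<le> real (Suc s) * ((deg v)\<^sup>2 + q')"
    proof (cases "s = 0")
      case True
      then have "sum \<mu> B' = 0" using IH by simp
      then show ?thesis using True total q'_nonneg by simp
    next
      case False
      \<comment> \<open>The arithmetic-geometric mean inequality with weights that fit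
        \<open>(a + b)\<^sup>2 \<le> (s + 1) (a\<^sup>2 / s + b\<^sup>2)\<close>.\<close>
      have "0 \<le> (real s * deg v - sum \<mu> B')\<^sup>2 / s"
        by simp
      also have "(real s * deg v - sum \<mu> B')\<^sup>2 =
          s * (s * (deg v)\<^sup>2 - 2 * sum \<mu> B' * deg v) + (sum \<mu> B')\<^sup>2"
        by (simp add: power2_eq_square algebra_simps)
      also have "\<dots> / s = s * (deg v)\<^sup>2 - 2 * sum \<mu> B' * deg v + (sum \<mu> B')\<^sup>2 / s"
        using False by (simp add: add_divide_distrib)
      also have "(sum \<mu> B')\<^sup>2 / s \<le> q'"
        using IH False by (simp add: divide_le_eq mult.commute)
      finally show ?thesis
        using IH by (simp add: total power2_sum algebra_simps)
    qed
    also have "\<dots> \<le> real (Suc s) * (\<Sum>x\<in>B. \<Sum>y\<in>{y \<in> B. R x y}. \<mu> x * \<mu> y)"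
      using q by (intro mult_left_mono) auto
    finally show ?thesis .
  qed simp
qed

definition gray_blacks :: "'a crg \<Rightarrow> 'a \<Rightarrow> 'a set" where
  "gray_blacks K w = {b \<in> VB K. {w, b} \<in> EG K}"

lemma verts_complete_bipartite [simp]: "verts (complete_bipartite s t) = {..<s + t}"
  by (simp add: complete_bipartite_def)

lemma complete_bipartite_edge_iff:
  "{i, j} \<in> edges (complete_bipartite s t) \<longleftrightarrow>
     (i < s \<and> s \<le> j \<and> j < s + t) \<or> (j < s \<and> s \<le> i \<and> i < s + t)"
  by (auto simp: complete_bipartite_def doubleton_eq_iff)

lemma maps_to_complete_bipartiteI:
  assumes "\<And>i. i < s + t \<Longrightarrow> \<phi> i \<in> crg_verts K"
    and "\<And>i j. i < s \<Longrightarrow> s \<le> j \<Longrightarrow> j < s + t \<Longrightarrow>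
      (\<phi> i = \<phi> j \<and> \<phi> i \<in> VB K) \<or> {\<phi> i, \<phi> j} \<in> EB K \<union> EG K"
    and "\<And>i j. i < j \<Longrightarrow> j < s \<Longrightarrow>
      (\<phi> i = \<phi> j \<and> \<phi> i \<in> VW K) \<or> {\<phi> i, \<phi> j} \<in> EW K \<union> EG K"
    and "\<And>i j. s \<le> i \<Longrightarrow> i < j \<Longrightarrow> j < s + t \<Longrightarrow>
      (\<phi> i = \<phi> j \<and> \<phi> i \<in> VW K) \<or> {\<phi> i, \<phi> j} \<in> EW K \<union> EG K"
  shows "maps_to (complete_bipartite s t) K"
  unfolding maps_to_def
proof (intro exI[of _ \<phi>] conjI ballI impI)
  show "\<phi> ` verts (complete_bipartite s t) \<subseteq> crg_verts K"
    using assms(1) by (auto simp: complete_bipartite_def)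
  have *: "if {u, v} \<in> edges (complete_bipartite s t)
        then (\<phi> u = \<phi> v \<and> \<phi> u \<in> VB K) \<or> {\<phi> u, \<phi> v} \<in> EB K \<union> EG K
        else (\<phi> u = \<phi> v \<and> \<phi> u \<in> VW K) \<or> {\<phi> u, \<phi> v} \<in> EW K \<union> EG K"
    if "v < s + t" "u < v" for u v
  proof (cases "u < s \<and> s \<le> v")
    case True
    then show ?thesis
      using assms(2)[of u v] that by (simp add: complete_bipartite_edge_iff)
  next
    case False
    then show ?thesis
      using assms(3,4)[of u v] that by (cases "v < s") (auto simp: complete_bipartite_edge_iff)
  qed
  fix u v assume uv: "u \<in> verts (complete_bipartite s t)" "v \<in> verts (complete_bipartite s t)" "u \<noteq> v"
  show "if {u, v} \<in> edges (complete_bipartite s t)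
        then (\<phi> u = \<phi> v \<and> \<phi> u \<in> VB K) \<or> {\<phi> u, \<phi> v} \<in> EB K \<union> EG K
        else (\<phi> u = \<phi> v \<and> \<phi> u \<in> VW K) \<or> {\<phi> u, \<phi> v} \<in> EW K \<union> EG K"
  proof (cases "u < v")
    case True
    then show ?thesis using *[where u = u and v = v] uv by simp
  next
    case False
    have "{u, v} = {v, u}" "{\<phi> u, \<phi> v} = {\<phi> v, \<phi> u}"
      by auto
    then show ?thesis using *[where u = v and v = u] uv False
      by (auto split: if_splits)
  qed
qed

text \<open>Each side of the bipartition goes to one of the two white vertices.\<close>

lemma gray_whites_imp_maps_to:
  assumes "w \<in> VW K" "w' \<in> VW K" "{w, w'} \<in> EG K"
  shows "maps_to (complete_bipartite s t) K"
  using assms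
  by (intro maps_to_complete_bipartiteI[where \<phi> = "\<lambda>i. if i < s then w else w'"])
    (auto simp: crg_verts_def)

text \<open>The side of size \<open>s\<close> is spread over \<open>S\<close>, the other side goes to \<open>w\<close>.\<close>

lemma independent_gray_blacks_imp_maps_to:
  assumes K: "is_crg K" and w: "w \<in> VW K" and S: "S \<subseteq> gray_blacks K w" "card S = s" "0 < s"
    and nonblack: "\<And>x y. x \<in> S \<Longrightarrow> y \<in> S \<Longrightarrow> x \<noteq> y \<Longrightarrow> {x, y} \<notin> EB K"
  shows "maps_to (complete_bipartite s t) K"
proof -
  have "finite S"
    using S by (intro card_ge_0_finite) auto
  then obtain h where h: "bij_betw h {..<s} S"
    using S ex_bij_betw_nat_finite[of S] by (auto simp: atLeast0LessThan)
  have h_in: "h i \<in> S" if "i < s" for i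
    using h that by (auto simp: bij_betw_def)
  have h_gray: "h i \<in> VB K" "{w, h i} \<in> EG K" if "i < s" for i
    using h_in[OF that] S by (auto simp: gray_blacks_def)
  have h_nonblack: "{h i, h j} \<in> EW K \<union> EG K" if "i < j" "j < s" for i j
  proof -
    have "h i \<noteq> h j"
      using h that by (auto simp: bij_betw_def inj_on_def)
    moreover have "{h i, h j} \<in> pairs (crg_verts K)"
      using calculation h_gray that by (simp add: pair_in_pairs_iff crg_verts_def)
    moreover have "{h i, h j} \<notin> EB K"
      using calculation h_in that by (intro nonblack) auto
    ultimately show ?thesis
      using K unfolding is_crg_def by blast
  qed
  show ?thesis
    using w h_gray h_nonblack
    by (intro maps_to_complete_bipartiteI[where \<phi> = "\<lambda>i. if i < s then h i else w"])
      (auto simp: crg_verts_def insert_commute)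
qed

lemma crg_matrix_ge_nongray:
  assumes K: "is_crg K" and xy: "x \<in> crg_verts K" "y \<in> crg_verts K" "{x, y} \<notin> EG K"
    and p: "p \<le> 1 / 2"
  shows "p \<le> crg_matrix K p x y"
  using crg_pair_cases[OF K xy(1,2)] xy(3) p by (auto simp: crg_matrix_eq[OF K])

lemma crg_form_split:
  assumes K: "is_crg K"
  shows "crg_form K p \<mu> =
    (\<Sum>x\<in>VW K. \<Sum>y\<in>VW K. \<mu> x * (crg_matrix K p x y * \<mu> y)) +
    2 * (\<Sum>x\<in>VW K. \<Sum>y\<in>VB K. \<mu> x * (crg_matrix K p x y * \<mu> y)) +
    (\<Sum>x\<in>VB K. \<Sum>y\<in>VB K. \<mu> x * (crg_matrix K p x y * \<mu> y))"
proof -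
  have fin: "finite (VB K)" "finite (VW K)" and disj: "VB K \<inter> VW K = {}"
    using K by (auto simp: is_crg_def crg_verts_def)
  have "(\<Sum>x\<in>VB K. \<Sum>y\<in>VW K. \<mu> x * (crg_matrix K p x y * \<mu> y)) =
      (\<Sum>x\<in>VW K. \<Sum>y\<in>VB K. \<mu> x * (crg_matrix K p x y * \<mu> y))"
    by (subst sum.swap) (simp add: crg_matrix_eq[OF K] insert_commute mult_ac)
  then show ?thesis
    using fin disj
    by (simp add: crg_form_def crg_verts_def sum.union_disjoint sum.distrib)
qed

text \<open>Let \<open>B\<close> be a heaviest set of black vertices with gray edges to a common white vertex (or empty,
  if there is no white vertex), \<open>m\<close> its mass, \<open>r\<close> the mass of the other black vertices and \<open>W\<close> the
  white mass. Since a white vertex has gray edges to black mass at most \<open>m\<close>, the white-black part of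
  the form is at least \<open>2 p W r\<close>. Within black, \<open>B\<close> costs at least \<open>(1 - p) m\<^sup>2 / s\<close> by the
  weighted Turan inequality, and the diagonal entries of the other black vertices cost at least
  \<open>(1 - p) r\<^sup>2 / |K| \<ge> p r\<^sup>2\<close>; this is where \<open>p\<close> has to be small. The terms in \<open>W\<close> and
  \<open>r\<close> add up to \<open>p (W + r)\<^sup>2 = p (1 - m)\<^sup>2\<close>.\<close>

lemma crg_form_ge_near_zero:
  fixes K :: "'a crg"
  assumes K: "is_crg K" and F: "\<not> maps_to (complete_bipartite (Suc s) t) K"
    and \<mu>: "\<mu> \<in> masses K" and s: "0 < s"
    and p: "0 < p" "p \<le> 1 / (real (card (crg_verts K)) + 1)"
  shows "p - real s * p\<^sup>2 \<le> crg_form K p \<mu>"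
proof -
  define k where "k = real (card (crg_verts K))"
  have fin: "finite (VB K)" "finite (VW K)" "finite (crg_verts K)" and disj: "VB K \<inter> VW K = {}"
    using K by (auto simp: is_crg_def crg_verts_def)
  have k: "1 \<le> k"
    using K fin by (simp add: k_def is_crg_def Suc_le_eq card_gt_0_iff)
  have p_k: "p * k \<le> 1 - p"
    using p k by (simp add: k_def field_simps)
  moreover have "p * 1 \<le> p * k"
    using p k by (intro mult_left_mono) auto
  ultimately have p_half: "p \<le> 1 / 2"
    by simp
  have nn: "0 \<le> \<mu> x" for x
    using \<mu> by (simp add: masses_def)
  define W where "W = sum \<mu> (VW K)"
  have total: "W + sum \<mu> (VB K) = 1"
    using \<mu> fin disj by (simp add: W_def masses_def crg_verts_def sum.union_disjoint)
  let ?M = "crg_matrix K p"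
  have M_nonneg: "0 \<le> ?M x y" for x y
    using p p_half by (intro crg_matrix_nonneg) auto
  obtain B where B: "B \<subseteq> VB K"
    "\<And>w. w \<in> VW K \<Longrightarrow> sum \<mu> (gray_blacks K w) \<le> sum \<mu> B"
    "\<And>S. S \<subseteq> B \<Longrightarrow> card S = Suc s \<Longrightarrow> \<exists>x\<in>S. \<exists>y\<in>S. x \<noteq> y \<and> {x, y} \<in> EB K"
  proof (cases "VW K = {}")
    case True
    show thesis
      by (rule that[of "{}"]) (use True in auto)
  next
    case False
    then obtain w where w: "w \<in> VW K"
      "\<And>w'. w' \<in> VW K \<Longrightarrow> - sum \<mu> (gray_blacks K w) \<le> - sum \<mu> (gray_blacks K w')"
      using arg_min_if_finite[of "VW K" "\<lambda>w. - sum \<mu> (gray_blacks K w)"] fin by (metis not_less)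
    show thesis
    proof (rule that[of "gray_blacks K w"])
      show "gray_blacks K w \<subseteq> VB K"
        by (auto simp: gray_blacks_def)
      show "sum \<mu> (gray_blacks K w') \<le> sum \<mu> (gray_blacks K w)" if "w' \<in> VW K" for w'
        using w(2)[OF that] by simp
      show "\<exists>x\<in>S. \<exists>y\<in>S. x \<noteq> y \<and> {x, y} \<in> EB K"
        if "S \<subseteq> gray_blacks K w" "card S = Suc s" for S
        using independent_gray_blacks_imp_maps_to[OF K w(1) that] F by blast
    qed
  qed
  define m r where "m = sum \<mu> B" and "r = sum \<mu> (VB K - B)"
  have black_mass: "sum \<mu> (VB K) = m + r"
    unfolding m_def r_def using B(1) fin by (simp add: sum.subset_diff)
  have pos: "0 \<le> W" "0 \<le> m" "0 \<le> r"
    using nn by (auto simp: W_def m_def r_def intro!: sum_nonneg)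
  have WW: "p * W\<^sup>2 \<le> (\<Sum>x\<in>VW K. \<Sum>y\<in>VW K. \<mu> x * (?M x y * \<mu> y))"
  proof -
    have "p * W\<^sup>2 = (\<Sum>x\<in>VW K. \<Sum>y\<in>VW K. \<mu> x * (p * \<mu> y))"
      by (simp add: W_def power2_eq_square sum_product sum_distrib_left mult_ac)
    also have "\<dots> \<le> (\<Sum>x\<in>VW K. \<Sum>y\<in>VW K. \<mu> x * (?M x y * \<mu> y))"
    proof (intro sum_mono mult_left_mono mult_right_mono nn)
      fix x y assume "x \<in> VW K" "y \<in> VW K"
      then have "{x, y} \<notin> EG K" "x \<in> crg_verts K" "y \<in> crg_verts K"
        using gray_whites_imp_maps_to[of x K y] F by (auto simp: crg_verts_def)
      then show "p \<le> ?M x y"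
        using p_half by (intro crg_matrix_ge_nongray[OF K])
    qed
    finally show ?thesis .
  qed
  have WB: "p * W * r \<le> (\<Sum>x\<in>VW K. \<Sum>y\<in>VB K. \<mu> x * (?M x y * \<mu> y))"
  proof -
    have "p * W * r = (\<Sum>x\<in>VW K. \<mu> x * (p * r))"
      by (simp add: W_def sum_distrib_left sum_distrib_right mult_ac)
    also have "\<dots> \<le> (\<Sum>x\<in>VW K. \<mu> x * (\<Sum>y\<in>VB K. ?M x y * \<mu> y))"
    proof (intro sum_mono mult_left_mono nn)
      fix x assume x: "x \<in> VW K"
      have sub: "gray_blacks K x \<subseteq> VB K"
        by (auto simp: gray_blacks_def)
      have "sum \<mu> (VB K) = sum \<mu> (VB K - gray_blacks K x) + sum \<mu> (gray_blacks K x)"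
        using fin by (intro sum.subset_diff sub)
      then have "r \<le> sum \<mu> (VB K - gray_blacks K x)"
        using B(2)[OF x] black_mass by (simp add: m_def)
      then have "p * r \<le> (\<Sum>y\<in>VB K - gray_blacks K x. p * \<mu> y)"
        using p by (simp add: mult_left_mono flip: sum_distrib_left)
      also have "\<dots> \<le> (\<Sum>y\<in>VB K - gray_blacks K x. ?M x y * \<mu> y)"
        using x p_half
        by (intro sum_mono mult_right_mono nn crg_matrix_ge_nongray[OF K])
          (auto simp: crg_verts_def gray_blacks_def)
      also have "\<dots> \<le> (\<Sum>y\<in>VB K. ?M x y * \<mu> y)"
        using fin nn M_nonneg by (intro sum_mono2) auto
      finally show "p * r \<le> (\<Sum>y\<in>VB K. ?M x y * \<mu> y)" .
    qed
    also have "\<dots> = (\<Sum>x\<in>VW K. \<Sum>y\<in>VB K. \<mu> x * (?M x y * \<mu> y))"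
      by (simp add: sum_distrib_left)
    finally show ?thesis .
  qed
  have BB: "(1 - p) * (m\<^sup>2 / s) + p * r\<^sup>2 \<le> (\<Sum>x\<in>VB K. \<Sum>y\<in>VB K. \<mu> x * (?M x y * \<mu> y))"
  proof -
    define R where "R x y \<longleftrightarrow> {x, y} \<in> black_cells K" for x y
    have M_R: "?M x y \<ge> 1 - p" if "R x y" for x y
      using that p p_half by (auto simp: R_def crg_matrix_eq[OF K])
    have finB: "finite B"
      using B(1) fin finite_subset by blast
    have "m\<^sup>2 \<le> real s * (\<Sum>x\<in>B. \<Sum>y\<in>{y \<in> B. R x y}. \<mu> x * \<mu> y)"
      unfolding m_def
    proof (rule weighted_Turan[OF finB nn])
      show "R x x" if "x \<in> B" for x
        using that B(1) by (auto simp: R_def black_cells_def)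
      show "R y x" if "R x y" for x y
        using that by (simp add: R_def insert_commute)
      show "\<exists>x\<in>S. \<exists>y\<in>S. x \<noteq> y \<and> R x y" if "S \<subseteq> B" "card S = Suc s" for S
        using B(3)[OF that] by (auto simp: R_def black_cells_def)
    qed
    then have "(1 - p) * (m\<^sup>2 / s) \<le> (1 - p) * (\<Sum>x\<in>B. \<Sum>y\<in>{y \<in> B. R x y}. \<mu> x * \<mu> y)"
      using s p_half by (intro mult_left_mono) (auto simp: field_simps)
    also have "\<dots> = (\<Sum>x\<in>B. \<Sum>y\<in>{y \<in> B. R x y}. \<mu> x * ((1 - p) * \<mu> y))"
      by (simp add: sum_distrib_left mult_ac)
    also have "\<dots> \<le> (\<Sum>x\<in>B. \<Sum>y\<in>{y \<in> B. R x y}. \<mu> x * (?M x y * \<mu> y))"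
      using M_R by (intro sum_mono mult_left_mono mult_right_mono nn) auto
    also have "\<dots> \<le> (\<Sum>x\<in>B. \<Sum>y\<in>VB K. \<mu> x * (?M x y * \<mu> y))"
      using fin B(1) nn M_nonneg by (intro sum_mono sum_mono2) auto
    finally have 1: "(1 - p) * (m\<^sup>2 / s) \<le> (\<Sum>x\<in>B. \<Sum>y\<in>VB K. \<mu> x * (?M x y * \<mu> y))" .
    have "p * r\<^sup>2 \<le> p * (card (VB K - B) * (\<Sum>x\<in>VB K - B. (\<mu> x)\<^sup>2))"
      using sum_squared_le_sum_of_squares[of \<mu> "VB K - B"] fin p
      by (intro mult_left_mono) (auto simp: r_def mult.commute)
    also have "\<dots> \<le> p * (k * (\<Sum>x\<in>VB K - B. (\<mu> x)\<^sup>2))"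
    proof -
      have "card (VB K - B) \<le> card (crg_verts K)"
        using fin by (intro card_mono) (auto simp: crg_verts_def)
      then show ?thesis
        using p by (intro mult_left_mono mult_right_mono sum_nonneg) (auto simp: k_def)
    qed
    also have "\<dots> \<le> (1 - p) * (\<Sum>x\<in>VB K - B. (\<mu> x)\<^sup>2)"
      using mult_right_mono[OF p_k, of "\<Sum>x\<in>VB K - B. (\<mu> x)\<^sup>2"] by (simp add: sum_nonneg mult_ac)
    also have "\<dots> = (\<Sum>x\<in>VB K - B. \<mu> x * ((1 - p) * \<mu> x))"
      by (simp add: sum_distrib_left power2_eq_square mult_ac)
    also have "\<dots> \<le> (\<Sum>x\<in>VB K - B. \<Sum>y\<in>VB K. \<mu> x * (?M x y * \<mu> y))"
    proof (intro sum_mono)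
      fix x assume x: "x \<in> VB K - B"
      have "\<mu> x * ((1 - p) * \<mu> x) \<le> \<mu> x * (?M x x * \<mu> x)"
        using x by (intro mult_left_mono mult_right_mono nn M_R) (auto simp: R_def black_cells_def)
      also have "\<dots> \<le> (\<Sum>y\<in>VB K. \<mu> x * (?M x y * \<mu> y))"
        using x fin nn M_nonneg member_le_sum[of x "VB K" "\<lambda>y. \<mu> x * (?M x y * \<mu> y)"] by auto
      finally show "\<mu> x * ((1 - p) * \<mu> x) \<le> (\<Sum>y\<in>VB K. \<mu> x * (?M x y * \<mu> y))" .
    qed
    finally have 2: "p * r\<^sup>2 \<le> (\<Sum>x\<in>VB K - B. \<Sum>y\<in>VB K. \<mu> x * (?M x y * \<mu> y))" .
    have "(\<Sum>x\<in>VB K. \<Sum>y\<in>VB K. \<mu> x * (?M x y * \<mu> y)) =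
        (\<Sum>x\<in>VB K - B. \<Sum>y\<in>VB K. \<mu> x * (?M x y * \<mu> y)) +
        (\<Sum>x\<in>B. \<Sum>y\<in>VB K. \<mu> x * (?M x y * \<mu> y))"
      using B(1) fin by (intro sum.subset_diff) auto
    then show ?thesis
      using 1 2 by linarith
  qed
  have "p - real s * p\<^sup>2 \<le> p * (1 - m)\<^sup>2 + (1 - p) * (m\<^sup>2 / s)"
  proof -
    \<comment> \<open>Complete the square in \<open>m\<close>: the optimum is near \<open>m = s p\<close>.\<close>
    have "1 * m\<^sup>2 \<le> s * m\<^sup>2"
      using s by (intro mult_right_mono) auto
    then have "m\<^sup>2 / s \<le> m\<^sup>2"
      using s by (simp add: field_simps)
    then have "0 \<le> (m - real s * p)\<^sup>2 / s + p * (m\<^sup>2 - m\<^sup>2 / s)"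
      using p by (intro add_nonneg_nonneg mult_nonneg_nonneg) auto
    also have "(m - real s * p)\<^sup>2 / s = m\<^sup>2 / s - 2 * m * p + real s * p\<^sup>2"
      using s by (simp add: power2_eq_square field_simps)
    finally show ?thesis
      by (simp add: power2_eq_square algebra_simps diff_divide_distrib)
  qed
  also have "\<dots> = p * W\<^sup>2 + 2 * (p * W * r) + ((1 - p) * (m\<^sup>2 / s) + p * r\<^sup>2)"
  proof -
    have "1 - m = W + r"
      using total black_mass by simp
    then show ?thesis
      by (simp only: power2_sum) (simp add: algebra_simps)
  qed
  also have "\<dots> \<le> crg_form K p \<mu>"
    unfolding crg_form_split[OF K] using WW WB BB by linarith
  finally show ?thesis .
qed

section \<open>Finite fields of characteristic two\<close>

lemma char_2_add_self:
  assumes "CHAR('a::comm_ring_1) = 2"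
  shows "(x::'a) + x = 0"
proof -
  have "of_nat 2 = (0::'a)"
    using of_nat_CHAR[where ?'a = 'a] assms by simp
  then have "2 = (0::'a)" by simp
  then show ?thesis by (metis mult_2 mult_zero_left)
qed

lemma char_2_add_eq_0_iff:
  assumes "CHAR('a::comm_ring_1) = 2"
  shows "(x::'a) + y = 0 \<longleftrightarrow> x = y"
proof
  assume "x + y = 0"
  then have "x + y = y + y"
    by (simp add: char_2_add_self[OF assms])
  then show "x = y" by simp
qed (simp add: char_2_add_self[OF assms])

text \<open>For \<open>Q = 2\<^sup>n\<close> in an algebraically closed field of characteristic two this is the subfield with
  \<open>Q\<close> elements.\<close>

definition frobenius_fixed :: "nat \<Rightarrow> 'a::field set" where
  "frobenius_fixed Q = {x. x ^ Q = x}"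

lemma frobenius_2:
  assumes "CHAR('a::field) = 2"
  shows "((x::'a) + y) ^ 2 ^ n = x ^ 2 ^ n + y ^ 2 ^ n"
  using freshmans_dream'[where ?'a = 'a] assms by simp

lemma add_frobenius_fixed:
  assumes "CHAR('a::field) = 2" "(x::'a) \<in> frobenius_fixed (2 ^ n)" "y \<in> frobenius_fixed (2 ^ n)"
  shows "x + y \<in> frobenius_fixed (2 ^ n)"
  using assms by (simp add: frobenius_fixed_def frobenius_2)

lemma frobenius_fixed_power_eq_1:
  assumes "x \<in> frobenius_fixed Q" "x \<noteq> 0" "0 < Q"
  shows "x ^ (Q - 1) = 1"
proof -
  have "x * x ^ (Q - 1) = x ^ Q"
    using assms(3) by (metis Suc_diff_1 power_Suc)
  then show ?thesis using assms by (simp add: frobenius_fixed_def)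
qed

text \<open>The polynomial \<open>X\<^bsup>Q\<^esup> - X\<close> splits, and its derivative is the constant \<open>-1\<close>, so its \<open>Q\<close> roots
  are distinct.\<close>

lemma card_frobenius_fixed:
  assumes char: "CHAR('a::alg_closed_field) = 2" and n: "0 < n"
  shows "finite (frobenius_fixed (2 ^ n) :: 'a set)" "card (frobenius_fixed (2 ^ n) :: 'a set) = 2 ^ n"
proof -
  define f :: "'a poly" where "f = Polynomial.monom 1 (2 ^ n) - Polynomial.monom 1 1"
  have gt: "1 < (2::nat) ^ n"
    using n by (intro one_less_power) auto
  have deg: "Polynomial.degree f = 2 ^ n"
    unfolding f_def using gt
    by (subst diff_conv_add_uminus, subst degree_add_eq_left) (simp_all add: degree_monom_eq)
  have f0: "f \<noteq> 0"
    using deg gt by auto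
  have roots: "frobenius_fixed (2 ^ n) = {x. poly f x = 0}"
    by (simp add: frobenius_fixed_def f_def poly_monom)
  show "finite (frobenius_fixed (2 ^ n) :: 'a set)"
    unfolding roots using f0 by (rule poly_roots_finite)
  have pderiv: "poly (pderiv f) x = - 1" for x
  proof -
    have "of_nat (2 ^ n) = (0::'a)"
      using of_nat_CHAR[where ?'a = 'a] char n by (simp add: power_0_left)
    then show ?thesis
      by (simp add: f_def pderiv_diff pderiv_monom poly_monom)
  qed
  obtain A where A: "size A = Polynomial.degree f" "f = Polynomial.smult (Polynomial.lead_coeff f) (\<Prod>x\<in>#A. [:-x, 1:])"
    using alg_closed_imp_factorization[OF f0] by blast
  have count: "count A x \<le> 1" for x
  proof (rule ccontr)
    assume "\<not> ?thesis"
    then have "{#x, x#} \<subseteq># A"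
      by (auto simp: subseteq_mset_def)
    then obtain B where B: "A = {#x, x#} + B"
      by (metis subset_mset.add_diff_inverse)
    define g where "g = Polynomial.smult (Polynomial.lead_coeff f) (\<Prod>x\<in>#B. [:-x, 1:])"
    have "f = [:-x, 1:] * ([:-x, 1:] * g)"
      by (subst A(2)) (simp add: B g_def)
    then have "poly (pderiv f) x = poly (pderiv ([:-x, 1:] * ([:-x, 1:] * g))) x"
      by simp
    also have "\<dots> = 0"
      unfolding pderiv_mult poly_mult poly_add by simp
    finally have "poly (pderiv f) x = 0" .
    then show False
      using pderiv by simp
  qed
  have "set_mset A = {x. poly f x = 0}"
  proof -
    have "poly f x = Polynomial.lead_coeff f * (\<Prod>y\<in>#A. x - y)" for x
      by (subst A(2)) (simp add: poly_prod_mset)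
    then show ?thesis
      using f0 by (auto simp: prod_mset_zero_iff)
  qed
  moreover have "A = mset_set (set_mset A)"
  proof (rule multiset_eqI)
    fix x
    show "count A x = count (mset_set (set_mset A)) x"
      using count[of x] by (cases "x \<in># A") (auto simp: count_eq_zero_iff le_Suc_eq)
  qed
  ultimately show "card (frobenius_fixed (2 ^ n) :: 'a set) = 2 ^ n"
    unfolding roots using A(1) deg by (metis size_mset_set)
qed

lemma finite_card_roots_of_unity:
  assumes "0 < r"
  shows "finite {x::'a::field. x ^ r = 1}" "card {x::'a. x ^ r = 1} \<le> r"
proof -
  define f :: "'a poly" where "f = Polynomial.monom 1 r - 1"
  have deg: "Polynomial.degree f = r"
    unfolding f_def using assms
    by (subst diff_conv_add_uminus, subst degree_add_eq_left) (simp_all add: degree_monom_eq)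
  then have f0: "f \<noteq> 0"
    using assms by auto
  have roots: "{x. x ^ r = 1} = {x. poly f x = 0}"
    by (simp add: f_def poly_monom)
  show "finite {x::'a::field. x ^ r = 1}" "card {x::'a. x ^ r = 1} \<le> r"
    unfolding roots using poly_roots_finite[OF f0] card_poly_roots_bound[OF f0] deg by auto
qed

section \<open>Power graphs\<close>

text \<open>For \<open>Q = q\<^sup>2\<close> and \<open>c = q + 1\<close> this is the projective norm graph, whose adjacency is
  \<open>N (A + B) = a b\<close>. For constant \<open>c\<close> it is a close relative of Furedi's dense
  \<open>K\<^bsub>2,c+1\<^esub>\<close>-free graphs.\<close>

definition power_graph :: "nat \<Rightarrow> nat \<Rightarrow> nat \<Rightarrow> ('a::field \<times> 'a) graph" where
  "power_graph Q r c =
    (let V = frobenius_fixed Q \<times> {x. x ^ r = 1}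
     in \<lparr>verts = V,
        edges = {{u, v} | u v. u \<in> V \<and> v \<in> V \<and> (fst u + fst v) ^ c = snd u * snd v}\<rparr>)"

definition nbrs :: "'a graph \<Rightarrow> 'a \<Rightarrow> 'a set" where
  "nbrs G x = {y. {x, y} \<in> edges G}"

lemma verts_power_graph [simp]:
  "verts (power_graph Q r c) = frobenius_fixed Q \<times> {x. x ^ r = 1}"
  by (simp add: power_graph_def Let_def)

lemma power_graph_edge_iff:
  "{u, v} \<in> edges (power_graph Q r c) \<longleftrightarrow>
     u \<in> verts (power_graph Q r c) \<and> v \<in> verts (power_graph Q r c) \<and>
     (fst u + fst v) ^ c = snd u * snd v" (is "_ \<longleftrightarrow> ?adj u v")
proof
  assume "{u, v} \<in> edges (power_graph Q r c)"
  then obtain u' v' where "{u, v} = {u', v'}" "?adj u' v'"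
    by (auto simp: power_graph_def Let_def)
  then show "?adj u v"
    by (auto simp: doubleton_eq_iff add.commute mult.commute)
next
  assume "?adj u v"
  then show "{u, v} \<in> edges (power_graph Q r c)"
    unfolding power_graph_def Let_def by fastforce
qed

locale char_2_power_graph =
  fixes n r c :: nat and \<Gamma> :: "('a::alg_closed_field \<times> 'a) graph"
  assumes char: "CHAR('a) = 2" and n: "0 < n" and rc: "2 ^ n - 1 = r * c"
  defines "\<Gamma> \<equiv> power_graph (2 ^ n) r c"
begin

lemma pos: "0 < r" "0 < c"
proof -
  have "1 < (2::nat) ^ n"
    using n by (intro one_less_power) auto
  then have "0 < r * c"
    using rc by linarith
  then show "0 < r" "0 < c" by auto
qed

lemma snd_nonzero: "u \<in> verts \<Gamma> \<Longrightarrow> snd u \<noteq> 0"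
  using pos by (auto simp: \<Gamma>_def power_0_left)

lemma is_graph: "is_graph \<Gamma>"
proof -
  have "finite (verts \<Gamma>)"
    using card_frobenius_fixed[OF char n] finite_card_roots_of_unity[OF pos(1), where ?'a = 'a] by (simp add: \<Gamma>_def)
  moreover have "e \<in> pairs (verts \<Gamma>)" if e: "e \<in> edges \<Gamma>" for e
  proof -
    obtain u v where uv: "e = {u, v}"
      using e by (auto simp: \<Gamma>_def power_graph_def Let_def)
    have "u \<noteq> v"
      using e uv power_graph_edge_iff[of u v "2 ^ n" r c] snd_nonzero[of u] pos
      by (auto simp: \<Gamma>_def char_2_add_self[OF char] power_0_left)
    then show ?thesis
      using e uv power_graph_edge_iff[of u v "2 ^ n" r c]
      by (auto simp: \<Gamma>_def pairs_def)
  qed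
  ultimately show ?thesis
    by (auto simp: is_graph_def)
qed

lemma card_verts_le: "card (verts \<Gamma>) \<le> 2 ^ n * r"
  using finite_card_roots_of_unity(2)[OF pos(1), where ?'a = 'a] card_frobenius_fixed[OF char n]
  by (simp add: \<Gamma>_def card_cartesian_product)

lemma power_sum_root_of_unity:
  assumes "A \<in> frobenius_fixed (2 ^ n)" "B \<in> frobenius_fixed (2 ^ n)" "A \<noteq> (B::'a)"
  shows "((A + B) ^ c) ^ r = 1"
proof -
  have "((A + B) ^ c) ^ r = (A + B) ^ (2 ^ n - 1)"
    by (metis rc mult.commute power_mult)
  also have "\<dots> = 1"
    using assms add_frobenius_fixed[OF char] char_2_add_eq_0_iff[OF char]
    by (intro frobenius_fixed_power_eq_1) auto
  finally show ?thesis .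
qed

text \<open>A neighbour of \<open>(A, a)\<close> is determined by its first coordinate \<open>B \<noteq> A\<close>, and every such \<open>B\<close>
  occurs: \<open>(A + B)\<^sup>c / a\<close> is an \<open>r\<close>-th root of unity because \<open>(A + B)\<^bsup>Q - 1\<^esup> = 1\<close>.\<close>

lemma card_nbrs:
  assumes u: "u \<in> verts \<Gamma>"
  shows "card (nbrs \<Gamma> u) = 2 ^ n - 1"
proof -
  obtain A a where Aa: "u = (A, a)" by force
  have A: "A \<in> frobenius_fixed (2 ^ n)" and a: "a ^ r = 1" "a \<noteq> 0"
    using u snd_nonzero[OF u] by (auto simp: \<Gamma>_def Aa)
  have "nbrs \<Gamma> u = (\<lambda>B. (B, (A + B) ^ c / a)) ` (frobenius_fixed (2 ^ n) - {A})"
  proof (intro equalityI subsetI)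
    fix v assume "v \<in> nbrs \<Gamma> u"
    then have v: "v \<in> verts \<Gamma>" "(A + fst v) ^ c = a * snd v"
      by (auto simp: nbrs_def \<Gamma>_def Aa power_graph_edge_iff simp del: verts_power_graph)
    have "fst v \<noteq> A"
      using v snd_nonzero[OF v(1)] a pos by (auto simp: char_2_add_self[OF char] power_0_left)
    moreover have "v = (fst v, (A + fst v) ^ c / a)"
      using v(2) a by (simp add: prod_eq_iff)
    ultimately show "v \<in> (\<lambda>B. (B, (A + B) ^ c / a)) ` (frobenius_fixed (2 ^ n) - {A})"
      using v(1) by (intro image_eqI[of _ _ "fst v"]) (auto simp: \<Gamma>_def)
  next
    fix v assume "v \<in> (\<lambda>B. (B, (A + B) ^ c / a)) ` (frobenius_fixed (2 ^ n) - {A})"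
    then show "v \<in> nbrs \<Gamma> u"
      using A a power_sum_root_of_unity
      by (auto simp: nbrs_def \<Gamma>_def Aa power_graph_edge_iff power_divide)
  qed
  also have "card \<dots> = card (frobenius_fixed (2 ^ n) - {A})"
    by (intro card_image inj_onI) auto
  also have "\<dots> = 2 ^ n - 1"
    using A card_frobenius_fixed[OF char n] by simp
  finally show ?thesis .
qed

lemma nbr_fst_inj:
  assumes "v \<in> nbrs \<Gamma> u" "v' \<in> nbrs \<Gamma> u" "fst v = fst v'"
  shows "v = v'"
  using assms snd_nonzero[of u]
  by (auto simp: nbrs_def \<Gamma>_def power_graph_edge_iff prod_eq_iff simp del: verts_power_graph)

lemma nbrs_sym: "v \<in> nbrs \<Gamma> u \<longleftrightarrow> u \<in> nbrs \<Gamma> v"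
  by (simp add: nbrs_def insert_commute)

lemma nbrsD:
  assumes "v \<in> nbrs \<Gamma> u"
  shows "(fst u + fst v) ^ c = snd u * snd v" "snd u \<noteq> 0" "snd v \<noteq> 0" "fst u + fst v \<noteq> 0"
proof -
  have *: "u \<in> verts \<Gamma>" "v \<in> verts \<Gamma>" "(fst u + fst v) ^ c = snd u * snd v"
    using assms by (auto simp: nbrs_def \<Gamma>_def power_graph_edge_iff simp del: verts_power_graph)
  then show "(fst u + fst v) ^ c = snd u * snd v" "snd u \<noteq> 0" "snd v \<noteq> 0"
    using snd_nonzero by auto
  then show "fst u + fst v \<noteq> 0"
    using pos by (auto simp: power_0_left)
qed

text \<open>Dividing the two adjacency equations eliminates the second coordinate of a common neighbour
  \<open>w\<close>: the quotient \<open>(A + X) / (B + X)\<close>, where \<open>A\<close>, \<open>B\<close>, \<open>X\<close> are the first coordinates, has a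
  prescribed \<open>c\<close>-th power. There are at most \<open>c\<close> such quotients, and the quotient determines \<open>X\<close>
  since \<open>A \<noteq> B\<close>.\<close>

lemma card_common_nbrs:
  assumes "u \<noteq> v"
  shows "finite (nbrs \<Gamma> u \<inter> nbrs \<Gamma> v)" "card (nbrs \<Gamma> u \<inter> nbrs \<Gamma> v) \<le> c"
proof -
  have "finite (nbrs \<Gamma> u \<inter> nbrs \<Gamma> v) \<and> card (nbrs \<Gamma> u \<inter> nbrs \<Gamma> v) \<le> c"
  proof (cases "nbrs \<Gamma> u \<inter> nbrs \<Gamma> v = {}")
    case False
    then have uv: "fst u \<noteq> fst v" "snd u \<noteq> 0" "snd v \<noteq> 0"
      using nbr_fst_inj[of u _ v] assms nbrs_sym nbrsD by blast+
    obtain z where z: "z ^ c = snd u / snd v"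
      using nth_root_exists[of c] pos by blast
    have z0: "z \<noteq> 0"
      using z uv pos by (auto simp: power_0_left)
    define g where "g w = (fst u + fst w) / (fst v + fst w) / z" for w :: "'a \<times> 'a"
    have "inj_on g (nbrs \<Gamma> u \<inter> nbrs \<Gamma> v)"
    proof (rule inj_onI)
      fix w w' assume w: "w \<in> nbrs \<Gamma> u \<inter> nbrs \<Gamma> v" "w' \<in> nbrs \<Gamma> u \<inter> nbrs \<Gamma> v" "g w = g w'"
      have "fst v + fst w \<noteq> 0" "fst v + fst w' \<noteq> 0"
        using w nbrsD by blast+
      then have "(fst u + fst w) * (fst v + fst w') = (fst u + fst w') * (fst v + fst w)"
        using w(3) z0 by (simp add: g_def divide_simps split: if_splits)
      then have "(fst u - fst v) * (fst w' - fst w) = 0"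
        by (simp add: algebra_simps)
      then have "fst w = fst w'"
        using uv by simp
      then show "w = w'"
        using nbr_fst_inj w by blast
    qed
    moreover have "g ` (nbrs \<Gamma> u \<inter> nbrs \<Gamma> v) \<subseteq> {x. x ^ c = 1}"
    proof
      fix x assume "x \<in> g ` (nbrs \<Gamma> u \<inter> nbrs \<Gamma> v)"
      then obtain w where "w \<in> nbrs \<Gamma> u" "w \<in> nbrs \<Gamma> v" "x = g w"
        by auto
      then show "x \<in> {x. x ^ c = 1}"
        using nbrsD[of w u] nbrsD[of w v] z z0 uv
        by (simp add: g_def power_divide power_mult_distrib)
    qed
    ultimately show ?thesis
      using finite_card_roots_of_unity[OF pos(2), where ?'a = 'a]
      by (meson card_inj_on_le finite_imageD finite_subset le_trans)
  qed simp
  then show "finite (nbrs \<Gamma> u \<inter> nbrs \<Gamma> v)" "card (nbrs \<Gamma> u \<inter> nbrs \<Gamma> v) \<le> c"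
    by auto
qed

end

section \<open>No three vertices of a norm graph have three common neighbours\<close>

text \<open>The equations describe two circles with different centres for the norm form
  \<open>y\<^bsup>q + 1\<^esup> = y \<cdot> y\<^sup>q\<close>, where \<open>q = 2\<^sup>m\<close>. Their difference is linear in \<open>y\<close> and its
  conjugate \<open>y\<^sup>q\<close>; substituting for the conjugate in one circle leaves a quadratic equation.\<close>

lemma card_circle_inter:
  fixes u v a b :: "'a::field"
  assumes char: "CHAR('a) = 2" and "u \<noteq> v"
  shows "finite {y. (y + u) ^ (2 ^ m + 1) = a \<and> (y + v) ^ (2 ^ m + 1) = b}"
    and "card {y. (y + u) ^ (2 ^ m + 1) = a \<and> (y + v) ^ (2 ^ m + 1) = b} \<le> 2"
proof -
  define conj where "conj x = x ^ 2 ^ m" for x :: 'a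
  have conj_add: "conj (x + y) = conj x + conj y" for x y
    by (simp add: conj_def frobenius_2[OF char])
  have conj_diff: "conj u - conj v \<noteq> 0"
  proof
    assume "conj u - conj v = 0"
    then have "conj (u + v) = 0"
      unfolding conj_add char_2_add_eq_0_iff[OF char] by simp
    then show False
      using \<open>u \<noteq> v\<close> by (simp add: conj_def char_2_add_eq_0_iff[OF char])
  qed
  define \<alpha> \<beta> where "\<alpha> = - (conj u - conj v) / (u - v)"
    and "\<beta> = (a - b - (u * conj u - v * conj v)) / (u - v)"
  have \<alpha>: "\<alpha> \<noteq> 0"
    using conj_diff \<open>u \<noteq> v\<close> by (simp add: \<alpha>_def)
  define f where "f = [:u * (\<beta> + conj u) - a, \<beta> + conj u + u * \<alpha>, \<alpha>:]"
  have "f \<noteq> 0" and deg: "Polynomial.degree f = 2"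
    using \<alpha> by (simp_all add: f_def)
  have sub: "{y. (y + u) ^ (2 ^ m + 1) = a \<and> (y + v) ^ (2 ^ m + 1) = b} \<subseteq> {y. poly f y = 0}"
  proof
    fix y assume "y \<in> {y. (y + u) ^ (2 ^ m + 1) = a \<and> (y + v) ^ (2 ^ m + 1) = b}"
    then have a: "(y + u) * (conj y + conj u) = a" and b: "(y + v) * (conj y + conj v) = b"
      by (simp_all add: conj_def flip: frobenius_2[OF char])
    have "(u - v) * conj y = - (conj u - conj v) * y + (a - b - (u * conj u - v * conj v))"
      unfolding a[symmetric] b[symmetric] by (simp add: algebra_simps)
    then have "conj y =
        (- (conj u - conj v) * y + (a - b - (u * conj u - v * conj v))) / (u - v)"
      using \<open>u \<noteq> v\<close> by (metis nonzero_mult_div_cancel_left right_minus_eq)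
    then have "conj y = \<alpha> * y + \<beta>"
      by (simp add: \<alpha>_def \<beta>_def add_divide_distrib)
    then show "y \<in> {y. poly f y = 0}"
      using a by (simp add: f_def algebra_simps)
  qed
  have "finite {y. poly f y = 0}" "card {y. poly f y = 0} \<le> 2"
    using poly_roots_finite[OF \<open>f \<noteq> 0\<close>] card_poly_roots_bound[OF \<open>f \<noteq> 0\<close>] deg by auto
  then show "finite {y. (y + u) ^ (2 ^ m + 1) = a \<and> (y + v) ^ (2 ^ m + 1) = b}"
    "card {y. (y + u) ^ (2 ^ m + 1) = a \<and> (y + v) ^ (2 ^ m + 1) = b} \<le> 2"
    using sub by (auto intro: finite_subset le_trans[OF card_mono])
qed

context char_2_power_graph
begin

text \<open>Let \<open>A\<^sub>1\<close>, \<open>A\<^sub>2\<close>, \<open>A\<^sub>3\<close> and \<open>X\<close> be the first coordinates of \<open>u\<close>, \<open>v\<close>, \<open>w\<close> and of a common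
  neighbour. Dividing the equations of \<open>u\<close> and \<open>v\<close> by that of \<open>w\<close> prescribes the norms of
  \<open>(A\<^sub>i + X) / (A\<^sub>3 + X)\<close> for \<open>i = 1, 2\<close>. The inversion \<open>y = 1 / (A\<^sub>3 + X)\<close> turns these
  into two circle equations with centres \<open>1 / (A\<^sub>i - A\<^sub>3)\<close>.\<close>

lemma card_common_nbrs_3:
  assumes c: "c = 2 ^ m + 1" and distinct: "u \<noteq> v" "u \<noteq> w" "v \<noteq> w"
  shows "card (nbrs \<Gamma> u \<inter> nbrs \<Gamma> v \<inter> nbrs \<Gamma> w) \<le> 2"
proof (cases "nbrs \<Gamma> u \<inter> nbrs \<Gamma> v \<inter> nbrs \<Gamma> w = {}")
  case False
  let ?N = "nbrs \<Gamma> u \<inter> nbrs \<Gamma> v \<inter> nbrs \<Gamma> w"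
  have ne: "fst u \<noteq> fst v" "fst u \<noteq> fst w" "fst v \<noteq> fst w"
    using False nbr_fst_inj distinct nbrs_sym by blast+
  define U V where "U = 1 / (fst u - fst w)" and "V = 1 / (fst v - fst w)"
  have "U \<noteq> V"
    using ne by (auto simp: U_def V_def field_simps)
  define a b where "a = snd u / snd w * U ^ c" and "b = snd v / snd w * V ^ c"
  define g where "g x = 1 / (fst w + fst x)" for x :: "'a \<times> 'a"
  have nz: "fst w + fst x \<noteq> 0" if "x \<in> ?N" for x
    using nbrsD(4)[of x w] that by simp
  have "inj_on g ?N"
  proof (rule inj_onI)
    fix x x' assume x: "x \<in> ?N" "x' \<in> ?N" "g x = g x'"
    then have "fst x = fst x'"
      using nz by (simp add: g_def)
    then show "x = x'"
      using nbr_fst_inj x by blast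
  qed
  moreover have "g ` ?N \<subseteq> {y. (y + U) ^ (2 ^ m + 1) = a \<and> (y + V) ^ (2 ^ m + 1) = b}"
  proof safe
    fix x assume x: "x \<in> nbrs \<Gamma> u" "x \<in> nbrs \<Gamma> v" "x \<in> nbrs \<Gamma> w"
    have *: "(g x + 1 / (A - fst w)) ^ (2 ^ m + 1) = s / snd w * (1 / (A - fst w)) ^ c"
      if "A \<noteq> fst w" "(A + fst x) ^ c = s * snd x" for A s
    proof -
      have "g x + 1 / (A - fst w) = (A + fst x) / (fst w + fst x) * (1 / (A - fst w))"
        using nbrsD(4)[OF x(3)] that(1) by (simp add: g_def field_simps)
      then have "(g x + 1 / (A - fst w)) ^ c = (A + fst x) ^ c / (fst w + fst x) ^ c * (1 / (A - fst w)) ^ c"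
        by (simp only: power_mult_distrib power_divide)
      also have "(A + fst x) ^ c / (fst w + fst x) ^ c = s / snd w"
        using nbrsD[OF x(3)] that(2) by simp
      finally show ?thesis
        using c by simp
    qed
    show "(g x + U) ^ (2 ^ m + 1) = a"
      unfolding U_def a_def using nbrsD(1)[OF x(1)] ne by (intro *) auto
    show "(g x + V) ^ (2 ^ m + 1) = b"
      unfolding V_def b_def using nbrsD(1)[OF x(2)] ne by (intro *) auto
  qed
  ultimately show ?thesis
    using card_circle_inter[OF char \<open>U \<noteq> V\<close>] by (meson card_inj_on_le le_trans)
qed simp

end

section \<open>CRGs with black vertices only\<close>

definition black_crg :: "'a graph \<Rightarrow> 'a crg" where
  "black_crg \<Gamma> = \<lparr>VB = verts \<Gamma>, VW = {}, EB = {}, EW = pairs (verts \<Gamma>) - edges \<Gamma>, EG = edges \<Gamma>\<rparr>"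

lemma crg_verts_black_crg [simp]: "crg_verts (black_crg \<Gamma>) = verts \<Gamma>"
  by (simp add: crg_verts_def black_crg_def)

lemma is_crg_black_crg:
  assumes "is_graph \<Gamma>" "verts \<Gamma> \<noteq> {}"
  shows "is_crg (black_crg \<Gamma>)"
  using assms by (auto simp: is_crg_def is_graph_def) (auto simp: black_crg_def)

lemma nbrs_subset:
  assumes "is_graph \<Gamma>"
  shows "nbrs \<Gamma> x \<subseteq> verts \<Gamma> - {x}"
  using assms by (auto simp: nbrs_def is_graph_def pairs_def)

text \<open>The matrix is \<open>p J + (1 - 2 p) I - p A\<close> with \<open>J\<close> the all-ones matrix and \<open>A\<close> the adjacency
  matrix of \<open>\<Gamma>\<close>, so all its row sums agree.\<close>

lemma crg_form_black_crg_uniform: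
  assumes \<Gamma>: "is_graph \<Gamma>" "verts \<Gamma> \<noteq> {}" and reg: "\<And>x. x \<in> verts \<Gamma> \<Longrightarrow> card (nbrs \<Gamma> x) = d"
  shows "crg_form (black_crg \<Gamma>) p (\<lambda>x. if x \<in> verts \<Gamma> then 1 / card (verts \<Gamma>) else 0) =
    p - (p * (real d + 2) - 1) / card (verts \<Gamma>)"
proof -
  define V k where "V = verts \<Gamma>" and "k = real (card V)"
  have fin: "finite V" and k: "k > 0"
    using \<Gamma> by (auto simp: is_graph_def V_def k_def card_gt_0_iff)
  let ?M = "crg_matrix (black_crg \<Gamma>) p"
  have row: "(\<Sum>y\<in>V. ?M x y) = p * k + 1 - p * (real d + 2)" if x: "x \<in> V" for x
  proof -
    have N: "nbrs \<Gamma> x \<subseteq> V - {x}"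
      using nbrs_subset[OF \<Gamma>(1)] by (simp add: V_def)
    then have "x \<notin> nbrs \<Gamma> x"
      by blast
    then have "{x} \<notin> edges \<Gamma>"
      by (simp add: nbrs_def)
    then have "(\<Sum>y\<in>V. ?M x y) = (\<Sum>y\<in>V. p - (if y \<in> nbrs \<Gamma> x then p else 0) + (if y = x then 1 - 2 * p else 0))"
      using N x by (intro sum.cong refl)
        (auto simp: crg_matrix_def black_crg_def nbrs_def pair_in_pairs_iff V_def)
    also have "\<dots> = p * k - (\<Sum>y\<in>V. if y \<in> nbrs \<Gamma> x then p else 0) + (1 - 2 * p)"
      using fin x by (simp add: sum.distrib sum_subtractf k_def)
    also have "(\<Sum>y\<in>V. if y \<in> nbrs \<Gamma> x then p else 0) = p * d"
    proof -
      have "V \<inter> {y. y \<in> nbrs \<Gamma> x} = nbrs \<Gamma> x"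
        using N by auto
      then show ?thesis
        using fin reg x by (simp add: sum.If_cases V_def)
    qed
    finally show ?thesis
      by (simp add: algebra_simps)
  qed
  have "crg_form (black_crg \<Gamma>) p (\<lambda>x. if x \<in> V then 1 / card V else 0) =
      (\<Sum>x\<in>V. \<Sum>y\<in>V. 1 / k * (?M x y * (1 / k)))"
    by (simp add: crg_form_def V_def k_def)
  also have "\<dots> = (\<Sum>x\<in>V. (\<Sum>y\<in>V. ?M x y) / k / k)"
    by (simp add: sum_divide_distrib)
  also have "\<dots> = k * ((p * k + 1 - p * (real d + 2)) / k / k)"
    by (simp add: row k_def)
  also have "\<dots> = p - (p * (real d + 2) - 1) / k"
    using k by (simp add: field_simps)
  finally show ?thesis
    unfolding V_def k_def .
qed

text \<open>Among the \<open>p\<close> with \<open>p (d + 2) - 1 > s k p\<^sup>2\<close>, the choice \<open>p = 2 / (d + 2)\<close> makes the left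
  hand side equal to \<open>1\<close>, and the density hypothesis says that the right hand side is smaller.\<close>

lemma ed_Forb_less_of_regular_graph:
  assumes \<Gamma>: "is_graph \<Gamma>" "verts \<Gamma> \<noteq> {}" and reg: "\<And>x. x \<in> verts \<Gamma> \<Longrightarrow> card (nbrs \<Gamma> x) = d"
    and F: "\<not> maps_to F (black_crg \<Gamma>)"
    and dense: "4 * real s * card (verts \<Gamma>) < (real d + 2)\<^sup>2"
  shows "ed (Forb {F}) (2 / (real d + 2)) < 2 / (real d + 2) - real s * (2 / (real d + 2))\<^sup>2"
proof -
  define p where "p = 2 / (real d + 2)"
  have p: "0 \<le> p" "p \<le> 1" and pd: "p * (real d + 2) = 2"
    by (auto simp: p_def field_simps)
  let ?\<mu> = "\<lambda>x. if x \<in> verts \<Gamma> then 1 / real (card (verts \<Gamma>)) else 0"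
  have k: "0 < card (verts \<Gamma>)"
    using \<Gamma> by (auto simp: is_graph_def card_gt_0_iff)
  have "?\<mu> \<in> masses (black_crg \<Gamma>)"
    using k by (auto simp: masses_def)
  then have "ed (Forb {F}) p \<le> crg_form (black_crg \<Gamma>) p ?\<mu>"
    using F p by (intro ed_Forb_le_crg_form is_crg_black_crg \<Gamma>) (auto simp: family_maps_to_def)
  also have "\<dots> = p - 1 / card (verts \<Gamma>)"
    using crg_form_black_crg_uniform[OF \<Gamma> reg, of p] pd by simp
  also have "\<dots> < p - real s * p\<^sup>2"
  proof -
    have "real s * p\<^sup>2 * card (verts \<Gamma>) < 1"
      using dense by (simp add: p_def power_divide field_simps)
    then show ?thesis
      using k by (simp add: field_simps)
  qed
  finally show ?thesis
    by (simp add: p_def)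
qed

text \<open>Two non-adjacent vertices cannot share a black vertex, so the map is injective on either side of
  the bipartition. Only the ends of an edge may coincide, which is the contraction of a matching.\<close>

lemma maps_to_black_crgE:
  assumes "maps_to (complete_bipartite s t) (black_crg \<Gamma>)" and \<Gamma>: "is_graph \<Gamma>"
  obtains \<phi> where "inj_on \<phi> {..<s}" "inj_on \<phi> {s..<s + t}"
    "\<And>i j. i < s \<Longrightarrow> j \<in> {s..<s + t} \<Longrightarrow> \<phi> i = \<phi> j \<or> \<phi> j \<in> nbrs \<Gamma> (\<phi> i)"
proof -
  obtain \<phi> where \<phi>: "\<And>u v. u < s + t \<Longrightarrow> v < s + t \<Longrightarrow> u \<noteq> v \<Longrightarrow>
      (if {u, v} \<in> edges (complete_bipartite s t) then \<phi> u = \<phi> v \<or> {\<phi> u, \<phi> v} \<in> edges \<Gamma>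
       else {\<phi> u, \<phi> v} \<in> pairs (verts \<Gamma>))"
  proof -
    obtain \<phi> where "\<forall>u\<in>verts (complete_bipartite s t). \<forall>v\<in>verts (complete_bipartite s t). u \<noteq> v \<longrightarrow>
         (if {u, v} \<in> edges (complete_bipartite s t)
          then (\<phi> u = \<phi> v \<and> \<phi> u \<in> VB (black_crg \<Gamma>)) \<or> {\<phi> u, \<phi> v} \<in> EB (black_crg \<Gamma>) \<union> EG (black_crg \<Gamma>)
          else (\<phi> u = \<phi> v \<and> \<phi> u \<in> VW (black_crg \<Gamma>)) \<or> {\<phi> u, \<phi> v} \<in> EW (black_crg \<Gamma>) \<union> EG (black_crg \<Gamma>))"
      using assms(1) unfolding maps_to_def by blast
    then show thesis
      using \<Gamma> by (intro that[of \<phi>]) (auto simp: black_crg_def is_graph_def split: if_splits)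
  qed
  show thesis
  proof (rule that[of \<phi>])
    show "inj_on \<phi> {..<s}"
    proof (rule inj_onI, rule ccontr)
      fix i j assume "i \<in> {..<s}" "j \<in> {..<s}" "\<phi> i = \<phi> j" "i \<noteq> j"
      then show False
        using \<phi>[of i j] by (auto simp: complete_bipartite_edge_iff pairs_def)
    qed
    show "inj_on \<phi> {s..<s + t}"
    proof (rule inj_onI, rule ccontr)
      fix i j assume "i \<in> {s..<s + t}" "j \<in> {s..<s + t}" "\<phi> i = \<phi> j" "i \<noteq> j"
      then show False
        using \<phi>[of i j] by (auto simp: complete_bipartite_edge_iff pairs_def)
    qed
    show "\<phi> i = \<phi> j \<or> \<phi> j \<in> nbrs \<Gamma> (\<phi> i)" if "i < s" "j \<in> {s..<s + t}" for i j
      using \<phi>[of i j] that by (auto simp: complete_bipartite_edge_iff nbrs_def)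
  qed
qed

text \<open>The images of the \<open>t\<close> vertices on the large side are distinct, and all but two of them are
  common neighbours of the images of the two vertices on the small side.\<close>

lemma not_maps_to_of_small_codegree:
  assumes \<Gamma>: "is_graph \<Gamma>"
    and codeg: "\<And>x y. x \<noteq> y \<Longrightarrow> finite (nbrs \<Gamma> x \<inter> nbrs \<Gamma> y) \<and> card (nbrs \<Gamma> x \<inter> nbrs \<Gamma> y) \<le> c"
    and t: "c + 2 < t"
  shows "\<not> maps_to (complete_bipartite 2 t) (black_crg \<Gamma>)"
proof
  assume "maps_to (complete_bipartite 2 t) (black_crg \<Gamma>)"
  then obtain \<phi> where inj: "inj_on \<phi> {..<2}" "inj_on \<phi> {2..<2 + t}"
    and adj: "\<And>i j. i < 2 \<Longrightarrow> j \<in> {2..<2 + t} \<Longrightarrow> \<phi> i = \<phi> j \<or> \<phi> j \<in> nbrs \<Gamma> (\<phi> i)"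
    using \<Gamma> by (rule maps_to_black_crgE) blast
  have ne: "\<phi> 0 \<noteq> \<phi> 1"
    using inj_onD[OF inj(1), of 0 1] by auto
  let ?N = "nbrs \<Gamma> (\<phi> 0) \<inter> nbrs \<Gamma> (\<phi> 1)"
  have "\<phi> ` {2..<2 + t} \<subseteq> {\<phi> 0, \<phi> 1} \<union> ?N"
  proof safe
    fix j assume "j \<in> {2..<2 + t}" "\<phi> j \<noteq> \<phi> 1" "\<phi> j \<noteq> \<phi> 0"
    then show "\<phi> j \<in> nbrs \<Gamma> (\<phi> 0)" "\<phi> j \<in> nbrs \<Gamma> (\<phi> 1)"
      using adj[of 0 j] adj[of 1 j] by auto
  qed
  then have "card (\<phi> ` {2..<2 + t}) \<le> card ({\<phi> 0, \<phi> 1} \<union> ?N)"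
    using codeg[OF ne] by (intro card_mono) auto
  also have "\<dots> \<le> card {\<phi> 0, \<phi> 1} + card ?N"
    by (rule card_Un_le)
  also have "\<dots> \<le> 2 + c"
    using codeg[OF ne] ne by simp
  finally show False
    using t card_image[OF inj(2)] by simp
qed

section \<open>Bipartite double covers\<close>

definition double_cover :: "'a graph \<Rightarrow> ('a \<times> bool) graph" where
  "double_cover G = \<lparr>verts = verts G \<times> UNIV,
     edges = {{(u, b), (v, \<not> b)} | u v b. {u, v} \<in> edges G}\<rparr>"

lemma double_cover_edge_iff:
  "{(u, b), (v, c)} \<in> edges (double_cover G) \<longleftrightarrow> {u, v} \<in> edges G \<and> c = (\<not> b)"
proof
  assume "{(u, b), (v, c)} \<in> edges (double_cover G)"
  then obtain u' v' b' where "{(u, b), (v, c)} = {(u', b'), (v', \<not> b')}" "{u', v'} \<in> edges G"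
    by (auto simp: double_cover_def)
  then show "{u, v} \<in> edges G \<and> c = (\<not> b)"
    by (auto simp: doubleton_eq_iff insert_commute)
next
  assume "{u, v} \<in> edges G \<and> c = (\<not> b)"
  then show "{(u, b), (v, c)} \<in> edges (double_cover G)"
    unfolding double_cover_def by auto
qed

lemma nbrs_double_cover: "nbrs (double_cover G) (u, b) = nbrs G u \<times> {\<not> b}"
  by (auto simp: nbrs_def double_cover_edge_iff)

lemma is_graph_double_cover:
  assumes "is_graph G"
  shows "is_graph (double_cover G)"
proof -
  have "e \<in> pairs (verts (double_cover G))" if e: "e \<in> edges (double_cover G)" for e
  proof -
    obtain u v b where uv: "e = {(u, b), (v, \<not> b)}" "{u, v} \<in> edges G"
      using e by (auto simp: double_cover_def)
    then have "u \<in> verts G" "v \<in> verts G"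
      using assms by (auto simp: is_graph_def pairs_def)
    then show ?thesis
      unfolding uv(1) pair_in_pairs_iff by (simp add: double_cover_def)
  qed
  moreover have "finite (verts (double_cover G))"
    using assms by (simp add: is_graph_def double_cover_def)
  ultimately show ?thesis
    by (auto simp: is_graph_def)
qed

text \<open>If vertices \<open>i\<close> and \<open>j\<close> from opposite sides had the same image \<open>x\<close>, then a second
  vertex of the side of \<open>i\<close> and the two other vertices of the side of \<open>j\<close> would have images adjacent
  to \<open>x\<close>, hence on one side of the double cover, hence not adjacent to each other. They would have to
  coincide, against injectivity. So the map embeds \<open>K\<^bsub>3,3\<^esub>\<close> in the double cover, and projecting
  it to \<open>G\<close> yields three vertices with three common neighbours.\<close>

lemma not_maps_to_double_cover:
  assumes G: "is_graph G"
    and codeg: "\<And>u v w. u \<noteq> v \<Longrightarrow> u \<noteq> w \<Longrightarrow> v \<noteq> w \<Longrightarrow>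
      card (nbrs G u \<inter> nbrs G v \<inter> nbrs G w) \<le> 2"
  shows "\<not> maps_to (complete_bipartite 3 3) (black_crg (double_cover G))"
proof
  let ?D = "double_cover G"
  assume "maps_to (complete_bipartite 3 3) (black_crg ?D)"
  then obtain \<phi> :: "nat \<Rightarrow> 'a \<times> bool" where inj: "inj_on \<phi> {..<3}" "inj_on \<phi> {3..<3 + 3}"
    and adj: "\<And>i j. i < 3 \<Longrightarrow> j \<in> {3..<3 + 3} \<Longrightarrow> \<phi> i = \<phi> j \<or> \<phi> j \<in> nbrs ?D (\<phi> i)"
    using is_graph_double_cover[OF G] by (rule maps_to_black_crgE) blast
  have side: "snd y \<noteq> snd x" "fst y \<in> nbrs G (fst x)" if "y \<in> nbrs ?D x" for x y
  proof -
    have "y \<in> nbrs G (fst x) \<times> {\<not> snd x}"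
      using that nbrs_double_cover[of G "fst x" "snd x"] by simp
    then show "snd y \<noteq> snd x" "fst y \<in> nbrs G (fst x)"
      by (simp_all add: mem_Times_iff)
  qed
  have disj: "\<phi> i \<noteq> \<phi> j" if ij: "i < 3" "j \<in> {3..<3 + 3}" for i j
  proof
    assume eq: "\<phi> i = \<phi> j"
    obtain i' :: nat where i': "i' < 3" "i' \<noteq> i"
      by (rule that[of "if i = 0 then 1 else 0"]) auto
    have right: "\<phi> i' = \<phi> j'" if j': "j' \<in> {3..<3 + 3}" "j' \<noteq> j" for j'
    proof (rule ccontr)
      assume "\<phi> i' \<noteq> \<phi> j'"
      then have 1: "\<phi> j' \<in> nbrs ?D (\<phi> i')"
        using adj[OF i'(1) j'(1)] by blast
      have "\<phi> i' \<noteq> \<phi> j"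
        using inj_onD[OF inj(1), of i' i] i' ij(1) unfolding eq by blast
      then have 2: "\<phi> j \<in> nbrs ?D (\<phi> i')"
        using adj[OF i'(1) ij(2)] by blast
      have "\<phi> i \<noteq> \<phi> j'"
        using inj_onD[OF inj(2), of j' j] j' ij(2) unfolding eq by metis
      then have 3: "\<phi> j' \<in> nbrs ?D (\<phi> j)"
        using adj[OF ij(1) j'(1)] unfolding eq by blast
      show False
        using side(1)[OF 1] side(1)[OF 2] side(1)[OF 3] by blast
    qed
    obtain j1 j2 where j: "j1 \<in> {3..<3 + 3}" "j2 \<in> {3..<3 + 3}" "j1 \<noteq> j" "j2 \<noteq> j" "j1 \<noteq> j2"
      by (rule that[of "if j = 3 then 4 else 3" "if j = 5 then 4 else 5"]) auto
    have "\<phi> j1 = \<phi> j2"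
      using right[OF j(1,3)] right[OF j(2,4)] by simp
    then show False
      using inj_onD[OF inj(2) _ j(1,2)] j(5) by blast
  qed
  have nb: "\<phi> j \<in> nbrs ?D (\<phi> i)" if "i < 3" "j \<in> {3..<3 + 3}" for i j
    using adj[OF that] disj[OF that] by simp
  define u where "u i = fst (\<phi> i)" for i
  have snd_l: "snd (\<phi> i) \<noteq> snd (\<phi> 3)" if "i < 3" for i
    using side(1)[OF nb[of i 3]] that by simp
  have snd_r: "snd (\<phi> j) \<noteq> snd (\<phi> 0)" if "j \<in> {3..<3 + 3}" for j
    using side(1)[OF nb[of 0 j]] that by simp
  have inj_l: "inj_on u {..<3}"
  proof (rule inj_onI)
    fix i j assume "i \<in> {..<3}" "j \<in> {..<3}" "u i = u j"
    then show "i = j"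
      using snd_l[of i] snd_l[of j] by (intro inj_onD[OF inj(1)]) (simp_all add: prod_eq_iff u_def)
  qed
  have inj_r: "inj_on u {3..<3 + 3}"
  proof (rule inj_onI)
    fix i j assume "i \<in> {3..<3 + 3}" "j \<in> {3..<3 + 3}" "u i = u j"
    then show "i = j"
      using snd_r[of i] snd_r[of j] by (intro inj_onD[OF inj(2)]) (simp_all add: prod_eq_iff u_def)
  qed
  let ?N = "nbrs G (u 0) \<inter> nbrs G (u 1) \<inter> nbrs G (u 2)"
  have "u ` {3..<3 + 3} \<subseteq> ?N"
    using side(2)[OF nb[of 0]] side(2)[OF nb[of 1]] side(2)[OF nb[of 2]]
    unfolding u_def by fastforce
  moreover have "finite ?N"
    using nbrs_subset[OF G] G by (auto simp: is_graph_def intro: finite_subset)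
  ultimately have "3 \<le> card ?N"
    using card_mono[of ?N "u ` {3..<3 + 3}"] card_image[OF inj_r] by simp
  moreover have "u 0 \<noteq> u 1" "u 0 \<noteq> u 2" "u 1 \<noteq> u 2"
    using inj_onD[OF inj_l, of 0 1] inj_onD[OF inj_l, of 0 2] inj_onD[OF inj_l, of 1 2] by auto
  ultimately show False
    using codeg[of "u 0" "u 1" "u 2"] by simp
qed

section \<open>Accumulation at zero\<close>

lemma hereditary_Forb: "hereditary (Forb \<F>)"
  unfolding hereditary_def
proof (intro conjI ballI allI impI)
  fix G assume G: "G \<in> Forb \<F>"
  then show "is_graph G"
    by (simp add: Forb_def)
  { fix G' :: "nat graph" assume G': "is_graph G' \<and> graph_iso G G'"
    then obtain f where f: "bij_betw f (verts G) (verts G')" "edges G' = (`) f ` edges G"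
      by (auto simp: graph_iso_def)
    have sub: "edges G \<subseteq> Pow (verts G)"
      using G by (auto simp: Forb_def is_graph_def pairs_def)
    define g where "g = inv_into (verts G) f"
    have g: "bij_betw g (verts G') (verts G)"
      unfolding g_def using f(1) by (rule bij_betw_inv_into)
    have "induced_subgraph F G" if F: "induced_subgraph F G'" for F :: "nat graph"
    proof -
      obtain h where h: "inj_on h (verts F)" "h ` verts F \<subseteq> verts G'"
        "\<And>u v. u \<in> verts F \<Longrightarrow> v \<in> verts F \<Longrightarrow> {u, v} \<in> edges F \<longleftrightarrow> {h u, h v} \<in> edges G'"
        using F unfolding induced_subgraph_def by blast
      have edge: "{x, y} \<in> edges G' \<longleftrightarrow> {g x, g y} \<in> edges G" if "x \<in> verts G'" "y \<in> verts G'" for x y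
      proof -
        have xy: "x = f (g x)" "y = f (g y)" "g x \<in> verts G" "g y \<in> verts G"
          using that f(1) g by (auto simp: g_def bij_betw_def f_inv_into_f inv_into_into)
        then have "{x, y} = f ` {g x, g y}"
          by auto
        moreover have "f ` {g x, g y} \<in> (`) f ` edges G \<longleftrightarrow> {g x, g y} \<in> edges G"
        proof
          assume "f ` {g x, g y} \<in> (`) f ` edges G"
          then obtain e where e: "e \<in> edges G" "f ` {g x, g y} = f ` e"
            by auto
          then have "{g x, g y} = e"
            using sub xy f(1) inj_on_image_eq_iff[of f "verts G" "{g x, g y}" e]
            by (auto simp: bij_betw_def)
          then show "{g x, g y} \<in> edges G"
            using e by simp
        qed (rule imageI)
        ultimately show ?thesis
          using f(2) by simp
      qed
      have "inj_on (g \<circ> h) (verts F)"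
        using h(1,2) g by (intro comp_inj_on) (auto simp: bij_betw_def intro: inj_on_subset)
      moreover have "(g \<circ> h) ` verts F \<subseteq> verts G"
        using h(2) g by (auto simp: bij_betw_def)
      moreover have "{u, v} \<in> edges F \<longleftrightarrow> {(g \<circ> h) u, (g \<circ> h) v} \<in> edges G"
        if "u \<in> verts F" "v \<in> verts F" for u v
      proof -
        have "h u \<in> verts G'" "h v \<in> verts G'"
          using h(2) that by auto
        then show ?thesis
          using h(3)[OF that] edge by simp
      qed
      ultimately show ?thesis
        unfolding induced_subgraph_def by blast
    qed
    then show "G' \<in> Forb \<F>"
      using G G' by (auto simp: Forb_def)
  }
  { fix v assume "v \<in> verts G"
    have "is_graph (delete_vertex G v)"
      using G by (auto simp: Forb_def is_graph_def delete_vertex_def pairs_def)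
    moreover have "induced_subgraph F G" if "induced_subgraph F (delete_vertex G v)" for F :: "nat graph"
      using that unfolding induced_subgraph_def delete_vertex_def by (elim exE) (rule exI, auto)
    ultimately show "delete_vertex G v \<in> Forb \<F>"
      using G by (auto simp: Forb_def)
  }
qed

lemma nontrivial_Forb_complete_bipartite:
  assumes "0 < s" "0 < t"
  shows "nontrivial (Forb {complete_bipartite s t})"
  unfolding nontrivial_def
proof
  fix n :: nat
  let ?G = "\<lparr>verts = {..<n}, edges = {}\<rparr>"
  have "\<not> induced_subgraph (complete_bipartite s t) ?G"
  proof
    assume "induced_subgraph (complete_bipartite s t) ?G"
    then obtain f where "\<And>u v. u < s + t \<Longrightarrow> v < s + t \<Longrightarrow>
        {u, v} \<in> edges (complete_bipartite s t) \<longleftrightarrow> {f u, f v} \<in> edges ?G"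
      unfolding induced_subgraph_def by auto
    from this[of 0 s] show False
      using assms by (simp add: complete_bipartite_edge_iff)
  qed
  then show "\<exists>G\<in>Forb {complete_bipartite s t}. n \<le> card (verts G)"
    by (intro bexI[of _ ?G]) (auto simp: Forb_def is_graph_def)
qed

text \<open>Finitely many CRGs have a common interval on which \<open>crg_form_ge_near_zero\<close> applies to
  all of them.\<close>

lemma accumulation_at_zeroI:
  assumes s: "0 < s" and t: "0 < t"
    and small: "\<And>\<delta>. 0 < \<delta> \<Longrightarrow> \<exists>p. 0 < p \<and> p < \<delta> \<and>
      ed (Forb {complete_bipartite (Suc s) t}) p < p - real s * p\<^sup>2"
  shows "edit_accumulation_point (Forb {complete_bipartite (Suc s) t}) 0"
  unfolding edit_accumulation_point_def
proof (intro conjI)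
  let ?H = "Forb {complete_bipartite (Suc s) t}"
  show "\<not> regular_point ?H 0"
  proof
    assume "regular_point ?H 0"
    then obtain \<epsilon> \<K> where \<epsilon>: "\<epsilon> > 0" and \<K>: "finite \<K>" "\<K> \<noteq> {}" "\<K> \<subseteq> crgs ?H"
      and eq: "\<And>p. p \<in> {0 - \<epsilon><..<0 + \<epsilon>} \<inter> {0..1} \<Longrightarrow> ed ?H p = (MIN K\<in>\<K>. crg_g K p)"
      unfolding regular_point_def by blast
    define \<delta> where "\<delta> = Min (insert \<epsilon> ((\<lambda>K. 1 / (real (card (crg_verts K)) + 1)) ` \<K>))"
    have "\<delta> > 0"
      unfolding \<delta>_def using \<K>(1) \<epsilon> by (subst Min_gr_iff) auto
    then obtain p where p: "0 < p" "p < \<delta>" "ed ?H p < p - real s * p\<^sup>2"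
      using small by blast
    have \<delta>: "\<delta> \<le> \<epsilon>" "\<And>K. K \<in> \<K> \<Longrightarrow> \<delta> \<le> 1 / (real (card (crg_verts K)) + 1)"
      unfolding \<delta>_def using \<K>(1) by auto
    have lower: "p - real s * p\<^sup>2 \<le> crg_g K p" if K: "K \<in> \<K>" for K
    proof -
      have "is_crg K" "\<not> maps_to (complete_bipartite (Suc s) t) K"
        using \<K>(3) K is_graph_complete_bipartite by (auto simp: crgs_Forb family_maps_to_def)
      then show ?thesis
        using crg_g_attained[of K p] crg_form_ge_near_zero[of K s t _ p] s p \<delta>(2)[OF K]
        by (metis less_imp_le order_trans)
    qed
    obtain K where K: "K \<in> \<K>"
      using \<K>(2) by blast
    have "1 / (real (card (crg_verts K)) + 1) \<le> 1"
      by simp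
    then have "p \<le> 1"
      using p(2) \<delta>(2)[OF K] by linarith
    then have "ed ?H p = (MIN K\<in>\<K>. crg_g K p)"
      using p \<delta>(1) by (intro eq) auto
    also have "\<dots> \<ge> p - real s * p\<^sup>2"
      using \<K> lower by (subst Min_ge_iff) auto
    finally show False
      using p(3) by simp
  qed
qed (use t in \<open>auto simp: hereditary_Forb nontrivial_Forb_complete_bipartite\<close>)

section \<open>The two forbidden graphs\<close>

lemma of_nat_bit: "of_nat m = (of_bool (odd m) :: bit)"
  by (induction m) auto

lemma CHAR_bit: "CHAR(bit) = 2"
  by (rule CHAR_eqI) (auto simp: of_nat_bit)

lemma ex_small_power_of_two:
  assumes "0 < \<delta>"
  shows "\<exists>n. 2 / (2 ^ n + 1) < (\<delta>::real)"
proof -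
  obtain n where "2 / \<delta> < 2 ^ n"
    using real_arch_pow[of 2 "2 / \<delta>"] by auto
  then have "2 / \<delta> < 2 ^ n + 1"
    by linarith
  moreover have "0 < (2::real) ^ n + 1"
    by (intro add_pos_pos) auto
  ultimately have "2 / (2 ^ n + 1) < \<delta>"
    using assms by (simp only: pos_divide_less_eq mult.commute)
  then show ?thesis
    by blast
qed

text \<open>The number \<open>c = 5\<close> divides \<open>16\<^sup>n - 1\<close>. Density needs \<open>c \<ge> 4\<close>, as \<open>k \<le> Q (Q - 1) / c\<close> is compared
  with \<open>(Q + 1)\<^sup>2 / 4\<close>, and \<open>not_maps_to_of_small_codegree\<close> asks for \<open>c + 2 < t\<close>.\<close>

lemma ed_Forb_K_2_t_less:
  assumes t: "8 \<le> t" and n: "0 < n"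
  defines "p \<equiv> 2 / (2 ^ (4 * n) + 1)"
  shows "ed (Forb {complete_bipartite 2 t}) p < p - p\<^sup>2"
proof -
  have "\<exists>r. 16 ^ n = r * 5 + (1::nat)"
  proof (induction n)
    case (Suc n)
    then obtain r where "16 ^ n = r * 5 + (1::nat)" ..
    then have "16 ^ Suc n = (16 * r + 3) * 5 + (1::nat)"
      by simp
    then show ?case ..
  qed simp
  then obtain r where "16 ^ n = r * 5 + (1::nat)" ..
  then have r: "2 ^ (4 * n) - 1 = r * 5"
    by (simp add: power_mult)
  define \<Gamma> :: "(bit alg_closure \<times> bit alg_closure) graph" where
    "\<Gamma> = power_graph (2 ^ (4 * n)) r 5"
  interpret char_2_power_graph "4 * n" r 5 \<Gamma>
    using n r by unfold_locales (simp_all add: CHAR_bit \<Gamma>_def)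
  define Q :: real where "Q = 2 ^ (4 * n)"
  have Q1: "1 \<le> Q"
    by (simp add: Q_def)
  have d: "real (2 ^ (4 * n) - 1) + 2 = Q + 1"
    by (simp add: Q_def of_nat_diff)
  have rQ: "5 * real r = Q - 1"
    using arg_cong[OF r, of real] by (simp add: Q_def of_nat_diff)
  have "(0, 1) \<in> verts \<Gamma>"
    by (simp add: \<Gamma>_def frobenius_fixed_def power_0_left)
  then have ne: "verts \<Gamma> \<noteq> {}"
    by blast
  have "4 * real 1 * card (verts \<Gamma>) < (real (2 ^ (4 * n) - 1) + 2)\<^sup>2"
  proof -
    have "real (card (verts \<Gamma>)) \<le> real (2 ^ (4 * n) * r)"
      using card_verts_le by (simp only: of_nat_le_iff)
    then have "real (card (verts \<Gamma>)) \<le> Q * real r"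
      by (simp add: Q_def)
    then have "5 * real (card (verts \<Gamma>)) \<le> Q * (Q - 1)"
      unfolding rQ[symmetric] by simp
    also have "\<dots> < (Q + 1)\<^sup>2"
      using Q1 by (simp add: power2_eq_square algebra_simps)
    finally show ?thesis
      unfolding d by simp
  qed
  moreover have "\<not> maps_to (complete_bipartite 2 t) (black_crg \<Gamma>)"
    using is_graph card_common_nbrs t by (intro not_maps_to_of_small_codegree[of _ 5]) auto
  ultimately have "ed (Forb {complete_bipartite 2 t}) (2 / (real (2 ^ (4 * n) - 1) + 2)) <
      2 / (real (2 ^ (4 * n) - 1) + 2) - real 1 * (2 / (real (2 ^ (4 * n) - 1) + 2))\<^sup>2"
    using is_graph ne card_nbrs by (intro ed_Forb_less_of_regular_graph) auto
  then show ?thesis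
    unfolding d by (simp add: p_def Q_def)
qed

text \<open>Here \<open>k \<le> 2 q\<^sup>3\<close> and \<open>d = q\<^sup>2 - 1\<close>, so density needs \<open>16 q\<^sup>3 < (q\<^sup>2 + 1)\<^sup>2\<close>, which holds
  for \<open>q > 16\<close>.\<close>

lemma ed_Forb_K_3_3_less:
  assumes m: "5 \<le> m"
  defines "p \<equiv> 2 / (2 ^ (2 * m) + 1)"
  shows "ed (Forb {complete_bipartite 3 3}) p < p - 2 * p\<^sup>2"
proof -
  define r c :: nat where "r = 2 ^ m - 1" and "c = 2 ^ m + 1"
  have rc: "2 ^ (2 * m) - 1 = r * c"
  proof -
    obtain k where "2 ^ m = Suc k"
      using not0_implies_Suc[of "2 ^ m"] by auto
    then show ?thesis
      by (simp add: r_def c_def power_mult power2_eq_square power_mult_distrib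
          mult.commute[of 2 m])
  qed
  define \<Gamma> :: "(bit alg_closure \<times> bit alg_closure) graph" where
    "\<Gamma> = power_graph (2 ^ (2 * m)) r c"
  interpret char_2_power_graph "2 * m" r c \<Gamma>
    using m rc by unfold_locales (simp_all add: CHAR_bit \<Gamma>_def)
  let ?D = "double_cover \<Gamma>"
  define q :: real where "q = 2 ^ m"
  have q: "32 \<le> q"
    using power_increasing[OF m, of "2::real"] by (simp add: q_def)
  have Q: "2 ^ (2 * m) = q\<^sup>2"
    unfolding q_def by (metis power_mult mult.commute)
  have d: "real (2 ^ (2 * m) - 1) + 2 = q\<^sup>2 + 1"
    by (simp add: Q of_nat_diff)
  have "(0, 1) \<in> verts \<Gamma>"
    by (simp add: \<Gamma>_def frobenius_fixed_def power_0_left)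
  then have ne: "verts ?D \<noteq> {}"
    by (auto simp: double_cover_def)
  have "4 * real 2 * card (verts ?D) < (real (2 ^ (2 * m) - 1) + 2)\<^sup>2"
  proof -
    have "real (card (verts \<Gamma>)) \<le> real (2 ^ (2 * m) * r)"
      using card_verts_le by (simp only: of_nat_le_iff)
    also have "\<dots> = q\<^sup>2 * real r"
      by (simp add: Q)
    also have "\<dots> \<le> q\<^sup>2 * q"
      by (intro mult_left_mono) (auto simp: r_def q_def of_nat_diff)
    finally have "4 * real 2 * card (verts ?D) \<le> 16 * (q\<^sup>2 * q)"
      by (simp add: double_cover_def card_cartesian_product)
    also have "\<dots> < q * (q\<^sup>2 * q)"
      using q by (intro mult_strict_right_mono) auto
    also have "\<dots> \<le> (q\<^sup>2 + 1)\<^sup>2"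
      by (simp add: power2_eq_square algebra_simps)
    finally show ?thesis
      unfolding d .
  qed
  moreover have "\<not> maps_to (complete_bipartite 3 3) (black_crg ?D)"
    using is_graph card_common_nbrs_3[OF c_def] by (intro not_maps_to_double_cover) auto
  moreover have "card (nbrs ?D x) = 2 ^ (2 * m) - 1" if "x \<in> verts ?D" for x
  proof -
    have "card (nbrs ?D x) = card (nbrs \<Gamma> (fst x))"
      using nbrs_double_cover[of \<Gamma> "fst x" "snd x"] by (simp add: card_cartesian_product)
    then show ?thesis
      using that card_nbrs[of "fst x"] by (simp add: double_cover_def mem_Times_iff)
  qed
  ultimately have "ed (Forb {complete_bipartite 3 3}) (2 / (real (2 ^ (2 * m) - 1) + 2)) <
      2 / (real (2 ^ (2 * m) - 1) + 2) - real 2 * (2 / (real (2 ^ (2 * m) - 1) + 2))\<^sup>2"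
    using is_graph_double_cover[OF is_graph] ne by (intro ed_Forb_less_of_regular_graph) auto
  then show ?thesis
    unfolding d by (simp add: p_def Q)
qed

theorem theorem1p6:
  "edit_accumulation_point (Forb {complete_bipartite 3 3}) 0 \<and>
   (\<forall>t\<ge>9. edit_accumulation_point (Forb {complete_bipartite 2 t}) 0)"
proof (intro conjI allI impI)
  \<comment> \<open>The critical \<open>p = 2 / (d + 2)\<close> are available for \<open>d + 1 = 2\<^bsup>a n\<^esup>\<close> with all large
    \<open>n\<close>, hence arbitrarily close to zero.\<close>
  have small: "\<exists>p. 0 < p \<and> p < \<delta> \<and> P p" if \<delta>: "0 < \<delta>" and a: "0 < a"
    and P: "\<And>n. b \<le> n \<Longrightarrow> P (2 / (2 ^ (a * n) + 1))"
    for \<delta> :: real and P and a b :: nat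
  proof -
    obtain n where n: "2 / (2 ^ n + 1) < \<delta>"
      using ex_small_power_of_two[OF \<delta>] by blast
    have "1 * n \<le> a * (n + b)"
      using a by (intro mult_le_mono) auto
    then have "(2::real) ^ n \<le> 2 ^ (a * (n + b))"
      by (intro power_increasing) auto
    then have "2 / (2 ^ (a * (n + b)) + 1) \<le> 2 / (2 ^ n + 1 :: real)"
      by (intro divide_left_mono mult_pos_pos add_pos_pos) auto
    moreover have "0 < 2 / (2 ^ (a * (n + b)) + 1 :: real)"
      by (intro divide_pos_pos add_pos_pos) auto
    ultimately show ?thesis
      using n P[of "n + b"] by (meson le_add2 le_less_trans)
  qed
  have "edit_accumulation_point (Forb {complete_bipartite (Suc 2) 3}) 0"
  proof (rule accumulation_at_zeroI)
    show "\<exists>p. 0 < p \<and> p < \<delta> \<and> ed (Forb {complete_bipartite (Suc 2) 3}) p < p - real 2 * p\<^sup>2"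
      if "0 < \<delta>" for \<delta>
      using small[OF that, of 2 5 "\<lambda>p. ed (Forb {complete_bipartite 3 3}) p < p - 2 * p\<^sup>2"]
        ed_Forb_K_3_3_less by simp
  qed auto
  then show "edit_accumulation_point (Forb {complete_bipartite 3 3}) 0"
    by simp
  fix t :: nat assume t: "9 \<le> t"
  have "edit_accumulation_point (Forb {complete_bipartite (Suc 1) t}) 0"
  proof (rule accumulation_at_zeroI)
    show "\<exists>p. 0 < p \<and> p < \<delta> \<and> ed (Forb {complete_bipartite (Suc 1) t}) p < p - real 1 * p\<^sup>2"
      if "0 < \<delta>" for \<delta>
      using small[OF that, of 4 1 "\<lambda>p. ed (Forb {complete_bipartite 2 t}) p < p - p\<^sup>2"]
        ed_Forb_K_2_t_less[of t] t by (simp add: numeral_2_eq_2)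
  qed (use t in auto)
  then show "edit_accumulation_point (Forb {complete_bipartite 2 t}) 0"
    by (simp add: numeral_2_eq_2)
qed

end
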